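(* Let $A\in\mathbb{R}^{m\times n}$ be semi-monotone, let $A=P_1-R_1+S_1$ be a double proper weak regular splitting and $A=P_2-R_2+S_2$ a double proper regular splitting of $A$. Suppose $N(R_2)\supseteq N(P_2)$, $R(R_2)\subseteq R(P_2)$, $-1\notin\sigma(R_2P_1^{\dagger})$ and $\widehat{\mathcal{A}}^{\dagger}\geq 0$, where $\widehat{\mathcal{A}}=(I+R_2P_1^{\dagger})A$. If $P_2^{\dagger}R_2+P_2^{\dagger}S_2\leq 0$, then $\rho(\mathcal{W}_{12})\leq\rho(T_2)<1$, where $$\mathcal{W}_{12}=\begin{pmatrix} P_2^{\dagger}R_2P_1^{\dagger}R_1-P_2^{\dagger}S_2 & -P_2^{\dagger}R_2P_1^{\dagger}S_1\\ I & 0\end{pmatrix},\qquad T_2=\begin{pmatrix} P_2^{\dagger}R_2 & -P_2^{\dagger}S_2\\ I&0\end{pmatrix}.$$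
   Context: For $M\in\mathbb{R}^{m\times n}$, $M^{\dagger}$ is its Moore–Penrose inverse, $R(M)$, $N(M)$ its range and null space; inequalities are entrywise; $\rho$ is the spectral radius, $\sigma$ the spectrum. $A$ is semi-monotone if $A^{\dagger}\geq0$. A double splitting $A=P-R+S$ is a double proper splitting if $R(P)=R(A)$ and $N(P)=N(A)$; it is double proper regular if moreover $P^{\dagger}\geq0$, $R\geq0$, $S\leq0$; double proper weak regular if moreover $P^{\dagger}\geq 0$, $P^{\dagger}R\geq 0$, $P^{\dagger}S\leq 0$. *)

theory Defs
  imports "Jordan_Normal_Form.Spectral_Radius"
begin

definition mp_inverse :: "real mat \<Rightarrow> real mat" where
  "mp_inverse M = (THE X. X \<in> carrier_mat (dim_col M) (dim_row M)
      \<and> M * X * M = M \<and> X * M * X = X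
      \<and> transpose_mat (M * X) = M * X \<and> transpose_mat (X * M) = X * M)"

definition range_mat :: "real mat \<Rightarrow> real vec set" where
  "range_mat M = {M *\<^sub>v x | x. x \<in> carrier_vec (dim_col M)}"

definition null_mat :: "real mat \<Rightarrow> real vec set" where
  "null_mat M = {x \<in> carrier_vec (dim_col M). M *\<^sub>v x = 0\<^sub>v (dim_row M)}"

definition nonneg_mat :: "real mat \<Rightarrow> bool" where
  "nonneg_mat M = (\<forall>i < dim_row M. \<forall>j < dim_col M. M $$ (i, j) \<ge> 0)"

definition nonpos_mat :: "real mat \<Rightarrow> bool" where
  "nonpos_mat M = (\<forall>i < dim_row M. \<forall>j < dim_col M. M $$ (i, j) \<le> 0)"

definition semi_monotone :: "real mat \<Rightarrow> bool" where
  "semi_monotone A = nonneg_mat (mp_inverse A)"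

definition double_proper_splitting :: "real mat \<Rightarrow> real mat \<Rightarrow> real mat \<Rightarrow> real mat \<Rightarrow> bool" where
  "double_proper_splitting A P R S =
     (P \<in> carrier_mat (dim_row A) (dim_col A) \<and> R \<in> carrier_mat (dim_row A) (dim_col A)
      \<and> S \<in> carrier_mat (dim_row A) (dim_col A) \<and> A = P - R + S
      \<and> range_mat P = range_mat A \<and> null_mat P = null_mat A)"

definition double_proper_regular :: "real mat \<Rightarrow> real mat \<Rightarrow> real mat \<Rightarrow> real mat \<Rightarrow> bool" where
  "double_proper_regular A P R S =
     (double_proper_splitting A P R S \<and> nonneg_mat (mp_inverse P)
      \<and> nonneg_mat R \<and> nonpos_mat S)"

definition double_proper_weak_regular :: "real mat \<Rightarrow> real mat \<Rightarrow> real mat \<Rightarrow> real mat \<Rightarrow> bool" where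
  "double_proper_weak_regular A P R S =
     (double_proper_splitting A P R S \<and> nonneg_mat (mp_inverse P)
      \<and> nonneg_mat (mp_inverse P * R) \<and> nonpos_mat (mp_inverse P * S))"

definition cmat :: "real mat \<Rightarrow> complex mat" where
  "cmat M = map_mat complex_of_real M"

definition rho :: "real mat \<Rightarrow> real" where
  "rho M = spectral_radius (cmat M)"

end

(* Let l = rho(W) > 0 with Perron vector (l y, y), and put K = R2 P1^+ and H = (I + K) A (the matrix
   whose pseudoinverse is assumed nonnegative). Expanding P1^+ A turns the eigenvalue equation into
   l^2 P2 y = l R2 P1^+ R1 y - l S2 y - R2 P1^+ S1 y >= 0, and hence into
   l H y = (1 - l)(l P2 y - R2 P1^+ S1 y). As y = H^+ H y, this gives l < 1 and H y >= 0, so that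
   A^+ K A y = H^+ K H y >= 0. With g = A^+ (l P2 y - S2 y) one obtains
     (1 - l) g - l y = (1 - l) A^+ (-S2 - R2) y + A^+ K A y + (1 - l) A^+ R2 P1^+ R1 y >= 0,
   which says exactly that (g, g + y) is a subeigenvector of T2 for l, whence l <= rho(T2).
   The same computation with T2 in place of W shows rho(T2) < 1. *)
theory Submission
  imports Defs
begin

section \<open>Spectral radius of nonnegative matrices\<close>

text \<open>The Perron vector (l y, y) of W need not be a subeigenvector of T2. The first block of
  T2 (l y, y) - l (l y, y) is P2^+ (l z + (1 - l)(R2 P1^+ S1 y - S2 y)) with z = K A y; here R2 P1^+
  S1 y <= 0 has the wrong sign, and the sign of z is known only after A^+ has been applied. The
  vector x = (g, g + y) is the cure: it solves (I - T2) x = (l y, y), so it is the Neumann series of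
  T2 applied to the Perron vector of W, and T2 x >= l x turns into (1 - l) x >= (l y, y), an
  inequality between A^+ images. The matrices W and T2 may be reducible, so no positive eigenvector
  is at hand. A nonnegative one is obtained by a limit, and all comparisons go through nonnegative
  subeigenvectors and supersolutions. The splittings are rectangular, so P2^+ and H^+ cancel only on
  suitable subspaces. The control comes from the fact that M M^+ depends only on the range of M and
  M^+ M only on its null space; equations are therefore mostly stated on vectors.\<close>

lemma index_mult_mat_vec_sum:
  assumes "M \<in> carrier_mat m n" "v \<in> carrier_vec n" "i < m"
  shows "(M *\<^sub>v v) $ i = (\<Sum>j<n. M $$ (i, j) * v $ j)"
  using assms by (simp add: scalar_prod_def atLeast0LessThan)

lemma nonneg_mult_mat_vec:
  assumes M: "M \<in> carrier_mat m n" and "nonneg_mat M" and v: "0\<^sub>v n \<le> v"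
  shows "0\<^sub>v m \<le> M *\<^sub>v v"
proof -
  have "v \<in> carrier_vec n" using v by (auto simp: less_eq_vec_def)
  then show ?thesis
    using assms by (auto simp: less_eq_vec_def index_mult_mat_vec_sum[OF M] nonneg_mat_def
        simp del: index_mult_mat_vec intro!: sum_nonneg)
qed

lemma nonneg_mult_mat:
  assumes "M \<in> carrier_mat l m" "N \<in> carrier_mat m n" "nonneg_mat M" "nonneg_mat N"
  shows "nonneg_mat (M * N)"
  using assms by (auto simp: nonneg_mat_def scalar_prod_def intro!: sum_nonneg)

lemma mult_mat_vec_mono:
  assumes M: "M \<in> carrier_mat m n" and "nonneg_mat M" and y: "y \<in> carrier_vec n" and xy: "x \<le> y"
  shows "M *\<^sub>v x \<le> M *\<^sub>v y"
proof -
  have "x \<in> carrier_vec n" using y xy by (auto simp: less_eq_vec_def)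
  then show ?thesis
    using assms by (auto simp: less_eq_vec_def index_mult_mat_vec_sum[OF M] nonneg_mat_def
        simp del: index_mult_mat_vec intro!: sum_mono mult_left_mono)
qed

lemma nonneg_pow_mat:
  assumes "M \<in> carrier_mat n n" "nonneg_mat M"
  shows "nonneg_mat (M ^\<^sub>m k)"
proof (induction k)
  case 0
  then show ?case using assms by (auto simp: nonneg_mat_def)
next
  case (Suc k)
  then show ?case using nonneg_mult_mat[OF pow_carrier_mat[OF assms(1)] assms(1)] assms by simp
qed

lemma smult_vec_mono: "(0::real) \<le> a \<Longrightarrow> x \<le> y \<Longrightarrow> a \<cdot>\<^sub>v x \<le> a \<cdot>\<^sub>v y"
  by (auto simp: less_eq_vec_def intro: mult_left_mono)

lemma pow_mat_subeigenvector:
  assumes M: "M \<in> carrier_mat n n" "nonneg_mat M" and x: "x \<in> carrier_vec n"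
    and a: "0 \<le> a" and sub: "a \<cdot>\<^sub>v x \<le> M *\<^sub>v x"
  shows "a ^ k \<cdot>\<^sub>v x \<le> M ^\<^sub>m k *\<^sub>v x"
proof (induction k)
  case 0
  then show ?case using M x by simp
next
  case (Suc k)
  have Mk: "M ^\<^sub>m k \<in> carrier_mat n n" using M by simp
  have "a ^ Suc k \<cdot>\<^sub>v x = a \<cdot>\<^sub>v (a ^ k \<cdot>\<^sub>v x)" by (simp add: smult_smult_assoc)
  also have "\<dots> \<le> a \<cdot>\<^sub>v (M ^\<^sub>m k *\<^sub>v x)" using smult_vec_mono[OF a Suc] .
  also have "\<dots> = M ^\<^sub>m k *\<^sub>v (a \<cdot>\<^sub>v x)" using mult_mat_vec[OF Mk x] by simp
  also have "\<dots> \<le> M ^\<^sub>m k *\<^sub>v (M *\<^sub>v x)"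
    using mult_mat_vec_mono[OF Mk nonneg_pow_mat[OF M]] M x sub by simp
  also have "\<dots> = M ^\<^sub>m Suc k *\<^sub>v x" using assoc_mult_mat_vec[OF Mk M(1) x] by simp
  finally show ?case .
qed

section \<open>Eigenvalues and powers of a real matrix through its complexification\<close>

lemma cmat_carrier [simp]: "M \<in> carrier_mat m n \<Longrightarrow> cmat M \<in> carrier_mat m n"
  by (simp add: cmat_def)

lemma rho_eigenvector:
  assumes M: "M \<in> carrier_mat n n" and n: "0 < n"
  obtains k v where "eigenvector (cmat M) v k" "norm k = rho M"
  using spectral_radius_mem_max(1)[OF cmat_carrier[OF M] n]
  unfolding rho_def spectrum_def eigenvalue_def by auto

lemma eigenvalue_le_rho:
  assumes M: "M \<in> carrier_mat n n" and n: "0 < n" and "eigenvector (cmat M) v k"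
  shows "norm k \<le> rho M"
  using spectral_radius_mem_max(2)[OF cmat_carrier[OF M] n] assms(3)
  unfolding rho_def spectrum_def eigenvalue_def by blast

lemma rho_nonneg:
  assumes "M \<in> carrier_mat n n" "0 < n"
  shows "0 \<le> rho M"
  using rho_eigenvector[OF assms] by (metis norm_ge_zero)

text \<open>An eigenvalue k of the scaled matrix gives the eigenvalue s k of \<open>M\<close>. The
  scaling moves a threshold \<open>s\<close> above the spectral radius to 1, where powers are
  bounded.\<close>

lemma rho_smult_less_1:
  assumes M: "M \<in> carrier_mat n n" and n: "0 < n" and s: "rho M < s"
  shows "rho ((1/s) \<cdot>\<^sub>m M) < 1"
proof -
  have s0: "0 < s" using rho_nonneg[OF M n] s by simp
  have N: "(1/s) \<cdot>\<^sub>m M \<in> carrier_mat n n" using M by simp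
  obtain k v where ev: "eigenvector (cmat ((1/s) \<cdot>\<^sub>m M)) v k"
    and k: "norm k = rho ((1/s) \<cdot>\<^sub>m M)"
    using rho_eigenvector[OF N n] .
  have v: "v \<in> carrier_vec n" "v \<noteq> 0\<^sub>v n"
    and eq: "cmat ((1/s) \<cdot>\<^sub>m M) *\<^sub>v v = k \<cdot>\<^sub>v v"
    using ev N unfolding eigenvector_def by (auto simp: cmat_def)
  have *: "cmat ((1/s) \<cdot>\<^sub>m M) = complex_of_real (1/s) \<cdot>\<^sub>m cmat M"
    unfolding cmat_def by (rule eq_matI) auto
  have "cmat M *\<^sub>v v = (complex_of_real s * k) \<cdot>\<^sub>v v"
  proof (rule eq_vecI)
    fix i assume "i < dim_vec ((complex_of_real s * k) \<cdot>\<^sub>v v)"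
    then have i: "i < n" using v by simp
    have "(complex_of_real (1/s) \<cdot>\<^sub>m cmat M *\<^sub>v v) $ i = (k \<cdot>\<^sub>v v) $ i" using eq * by simp
    then have "complex_of_real (1/s) * ((cmat M *\<^sub>v v) $ i) = k * v $ i"
      using i v M by (simp add: cmat_def)
    then show "(cmat M *\<^sub>v v) $ i = ((complex_of_real s * k) \<cdot>\<^sub>v v) $ i"
      using i v s0 by (simp add: field_simps)
  qed (use v M in \<open>simp add: cmat_def\<close>)
  then have "eigenvector (cmat M) v (complex_of_real s * k)"
    using v M unfolding eigenvector_def by (simp add: cmat_def)
  from eigenvalue_le_rho[OF M n this] have "s * norm k \<le> rho M"
    using s0 by (simp add: norm_mult)
  then have "s * norm k < s * 1" using s by simp
  then show ?thesis using k s0 by simp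
qed

text \<open>The library bound on powers concerns complex matrices; it is read back to
  \<open>M\<close> because the embedding of the reals commutes with powers.\<close>

lemma rho_less_1_pow_bounded:
  assumes M: "M \<in> carrier_mat n n" and "rho M < 1"
  obtains c where "\<And>k i j. i < n \<Longrightarrow> j < n \<Longrightarrow> \<bar>(M ^\<^sub>m k) $$ (i, j)\<bar> \<le> c"
proof -
  obtain c where c: "\<And>k. norm_bound (cmat M ^\<^sub>m k) c"
    using spectral_radius_jnf_norm_bound_less_1_upper_triangular[OF cmat_carrier[OF M]] assms(2)
    unfolding rho_def by blast
  have "\<bar>(M ^\<^sub>m k) $$ (i, j)\<bar> \<le> c" if ij: "i < n" "j < n" for k i j
  proof -
    have "cmat M ^\<^sub>m k = cmat (M ^\<^sub>m k)"
      unfolding cmat_def by (simp add: of_real_hom.mat_hom_pow[OF M])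
    moreover have "norm ((cmat M ^\<^sub>m k) $$ (i, j)) \<le> c"
      using c[of k] ij M unfolding norm_bound_def by (simp add: cmat_def)
    ultimately show ?thesis using ij M by (simp add: cmat_def)
  qed
  then show ?thesis using that by blast
qed

section \<open>Subeigenvectors and supersolutions of nonnegative matrices\<close>

lemma nonneg_nonzero_vec_pos:
  assumes "0\<^sub>v n \<le> x" "x \<noteq> 0\<^sub>v n"
  obtains i where "i < n" "0 < (x :: real vec) $ i"
proof -
  have "\<exists>i<n. x $ i \<noteq> 0"
    using assms by (metis (no_types, lifting) eq_vecI index_zero_vec less_eq_vec_def)
  then show ?thesis using assms(1) that by (force simp: less_eq_vec_def)
qed

text \<open>If \<open>t\<close> exceeded \<open>rho M\<close>, some \<open>s\<close> would lie
  strictly between them. The powers of \<open>M / s\<close> are then bounded, whereas applied to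
  \<open>x\<close> they grow at least like \<open>(t/s) ^ k\<close> in any coordinate where
  \<open>x\<close> is positive.\<close>

lemma subeigenvector_le_rho:
  assumes M: "M \<in> carrier_mat n n" "nonneg_mat M"
    and x: "0\<^sub>v n \<le> x" "x \<noteq> 0\<^sub>v n" and sub: "t \<cdot>\<^sub>v x \<le> M *\<^sub>v x"
  shows "t \<le> rho M"
proof (rule ccontr)
  assume "\<not> t \<le> rho M"
  obtain i where i: "i < n" "0 < x $ i" using nonneg_nonzero_vec_pos[OF x] .
  have n: "0 < n" using i by simp
  have xc: "x \<in> carrier_vec n" using x(1) by (auto simp: less_eq_vec_def)
  define s where "s = (rho M + t) / 2"
  have s: "rho M < s" "s < t" "0 < s"
    using \<open>\<not> t \<le> rho M\<close> rho_nonneg[OF M(1) n] by (auto simp: s_def)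
  define N where "N = (1/s) \<cdot>\<^sub>m M"
  have N: "N \<in> carrier_mat n n" "nonneg_mat N"
    using M s by (auto simp: N_def nonneg_mat_def)
  obtain c where c: "\<And>k i j. i < n \<Longrightarrow> j < n \<Longrightarrow> \<bar>(N ^\<^sub>m k) $$ (i, j)\<bar> \<le> c"
    using rho_less_1_pow_bounded[OF N(1)] rho_smult_less_1[OF M(1) n s(1)] unfolding N_def by blast
  have subN: "(t/s) \<cdot>\<^sub>v x \<le> N *\<^sub>v x"
    using sub s M xc by (auto simp: N_def less_eq_vec_def divide_right_mono)
  have ts: "1 < t / s" using s by simp
  obtain k where "c * (\<Sum>j<n. x $ j) / x $ i < (t/s) ^ k" using real_arch_pow[OF ts] by blast
  then have "c * (\<Sum>j<n. x $ j) < (t/s) ^ k * x $ i" using i by (simp add: field_simps)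
  also have "\<dots> \<le> (N ^\<^sub>m k *\<^sub>v x) $ i"
    using pow_mat_subeigenvector[OF N xc _ subN, of k] s i xc N by (simp add: less_eq_vec_def)
  also have "\<dots> = (\<Sum>j<n. (N ^\<^sub>m k) $$ (i, j) * x $ j)"
    using index_mult_mat_vec_sum[OF pow_carrier_mat[OF N(1)] xc i(1)] .
  also have "\<dots> \<le> (\<Sum>j<n. c * x $ j)"
    using c[OF i(1)] x(1) by (intro sum_mono mult_right_mono) (auto simp: less_eq_vec_def abs_le_iff)
  finally show False by (simp add: sum_distrib_left)
qed

text \<open>The negative part of \<open>x\<close> would be a subeigenvector for \<open>t\<close>.\<close>
lemma supersolution_nonneg:
  assumes M: "M \<in> carrier_mat n n" "nonneg_mat M" and t: "rho M < t"
    and x: "x \<in> carrier_vec n" and super: "M *\<^sub>v x \<le> t \<cdot>\<^sub>v x"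
  shows "0\<^sub>v n \<le> x"
proof -
  define z where "z = vec n (\<lambda>i. max 0 (- x $ i))"
  have zc: "z \<in> carrier_vec n" by (simp add: z_def)
  have z0: "0\<^sub>v n \<le> z" by (simp add: z_def less_eq_vec_def)
  have "(t \<cdot>\<^sub>v z) $ i \<le> (M *\<^sub>v z) $ i" if i: "i < n" for i
  proof (cases "0 \<le> x $ i")
    case True
    then have "(t \<cdot>\<^sub>v z) $ i = 0" using i by (simp add: z_def)
    then show ?thesis
      using nonneg_mult_mat_vec[OF M z0] i M by (auto simp: less_eq_vec_def simp del: index_mult_mat_vec)
  next
    case False
    \<comment> \<open>In this row \<open>z\<close> agrees with \<open>- x\<close>, and in every
      other coordinate it dominates \<open>- x\<close>, so passing from \<open>- x\<close> to
      \<open>z\<close> under \<open>M\<close> only increases the sum.\<close>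
    have "(t \<cdot>\<^sub>v z) $ i = - ((t \<cdot>\<^sub>v x) $ i)" using i False x by (simp add: z_def)
    also have "\<dots> \<le> - ((M *\<^sub>v x) $ i)"
      using super i x by (simp add: less_eq_vec_def del: index_mult_mat_vec)
    also have "\<dots> = (\<Sum>j<n. M $$ (i, j) * (- x $ j))"
      using index_mult_mat_vec_sum[OF M(1) x i] by (simp add: sum_negf)
    also have "\<dots> \<le> (\<Sum>j<n. M $$ (i, j) * z $ j)"
      using M i by (intro sum_mono mult_left_mono) (auto simp: z_def nonneg_mat_def)
    also have "\<dots> = (M *\<^sub>v z) $ i" using index_mult_mat_vec_sum[OF M(1) zc i] by simp
    finally show ?thesis .
  qed
  then have "t \<cdot>\<^sub>v z \<le> M *\<^sub>v z" using zc M by (simp add: less_eq_vec_def)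
  then have "z = 0\<^sub>v n" using subeigenvector_le_rho[OF M z0] t by force
  then have "max 0 (- x $ i) = 0" if "i < n" for i
    using that unfolding z_def by (metis index_vec index_zero_vec(1))
  then have "0 \<le> x $ i" if "i < n" for i using that by (metis max.cobounded2 neg_le_0_iff_le)
  then show ?thesis using x by (simp add: less_eq_vec_def)
qed

text \<open>The entrywise moduli of an eigenvector for an eigenvalue of maximal modulus do it, by
  the triangle inequality and nonnegativity of \<open>M\<close>.\<close>

lemma rho_subeigenvector:
  assumes M: "M \<in> carrier_mat n n" "nonneg_mat M" and n: "0 < n"
  obtains u where "0\<^sub>v n \<le> u" "u \<noteq> 0\<^sub>v n" "rho M \<cdot>\<^sub>v u \<le> M *\<^sub>v u"
proof -
  obtain k v where ev: "eigenvector (cmat M) v k" and k: "norm k = rho M"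
    using rho_eigenvector[OF M(1) n] .
  have v: "v \<in> carrier_vec n" "v \<noteq> 0\<^sub>v n" and eq: "cmat M *\<^sub>v v = k \<cdot>\<^sub>v v"
    using ev M unfolding eigenvector_def by (auto simp: cmat_def)
  define u where "u = vec n (\<lambda>i. norm (v $ i))"
  have uc: "u \<in> carrier_vec n" by (simp add: u_def)
  have "0\<^sub>v n \<le> u" by (simp add: u_def less_eq_vec_def)
  moreover have "u \<noteq> 0\<^sub>v n"
  proof
    assume "u = 0\<^sub>v n"
    then have "norm (v $ i) = 0" if "i < n" for i
      using that unfolding u_def by (metis index_vec index_zero_vec(1))
    then have "v = 0\<^sub>v n" using v by (intro eq_vecI) auto
    then show False using v by simp
  qed
  moreover have "(rho M \<cdot>\<^sub>v u) $ i \<le> (M *\<^sub>v u) $ i" if i: "i < n" for i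
  proof -
    have "(rho M \<cdot>\<^sub>v u) $ i = norm ((cmat M *\<^sub>v v) $ i)"
      unfolding eq using i v k by (simp add: u_def norm_mult)
    also have "\<dots> = norm (\<Sum>j<n. cmat M $$ (i, j) * v $ j)"
      using i v M by (simp add: scalar_prod_def atLeast0LessThan cmat_def)
    also have "\<dots> \<le> (\<Sum>j<n. norm (cmat M $$ (i, j) * v $ j))" by (rule norm_sum)
    also have "\<dots> = (\<Sum>j<n. M $$ (i, j) * u $ j)"
      using i M by (intro sum.cong) (auto simp: u_def norm_mult cmat_def nonneg_mat_def)
    also have "\<dots> = (M *\<^sub>v u) $ i" using index_mult_mat_vec_sum[OF M(1) uc i] by simp
    finally show ?thesis .
  qed
  then have "rho M \<cdot>\<^sub>v u \<le> M *\<^sub>v u" using uc M by (simp add: less_eq_vec_def)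
  ultimately show ?thesis using that by blast
qed

text \<open>Bolzano-Weierstrass by induction on the number of coordinates: a monotone subsequence of
  the next coordinate converges because it is bounded, and thinning out keeps the limits already
  found.\<close>

lemma bounded_convergent_subseq:
  fixes f :: "nat \<Rightarrow> nat \<Rightarrow> real"
  assumes "\<And>k i. i < n \<Longrightarrow> \<bar>f k i\<bar> \<le> c"
  shows "\<exists>r l. strict_mono r \<and> (\<forall>i<n. (\<lambda>k. f (r k) i) \<longlonglongrightarrow> l i)"
  using assms
proof (induction n)
  case 0
  then show ?case by (auto intro: strict_mono_id)
next
  case (Suc n)
  then obtain r l where r: "strict_mono (r :: nat \<Rightarrow> nat)" "\<And>i. i < n \<Longrightarrow> (\<lambda>k. f (r k) i) \<longlonglongrightarrow> l i"
    by fastforce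
  obtain q where q: "strict_mono (q :: nat \<Rightarrow> nat)" "monoseq (\<lambda>k. f (r (q k)) n)"
    using seq_monosub[of "\<lambda>k. f (r k) n"] by blast
  have "Bseq (\<lambda>k. f (r (q k)) n)" using Suc.prems by (intro BseqI'[of _ c]) simp
  then obtain a where a: "(\<lambda>k. f (r (q k)) n) \<longlonglongrightarrow> a"
    using q Bseq_monoseq_convergent unfolding convergent_def by blast
  have "(\<lambda>k. f ((r \<circ> q) k) i) \<longlonglongrightarrow> (l(n := a)) i" if "i < Suc n" for i
    using that a LIMSEQ_subseq_LIMSEQ[OF r(2) q(1), of i]
    by (cases "i = n") (auto simp: o_def)
  then show ?case using strict_mono_o[OF r(1) q(1)] by blast
qed

text \<open>If \<open>v\<close> is in the kernel of \<open>t I - M\<close>, then \<open>v\<close>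
  and \<open>- v\<close> are both supersolutions, hence both nonnegative, so \<open>v = 0\<close>.
  The solution is written with the adjugate; it is again a supersolution because \<open>b\<close> is
  nonnegative, and so it is nonnegative too.\<close>

lemma solvable_above_rho:
  assumes M: "M \<in> carrier_mat n n" "nonneg_mat M" and t: "rho M < t"
    and b: "0\<^sub>v n \<le> b"
  obtains x where "0\<^sub>v n \<le> x" "t \<cdot>\<^sub>v x = M *\<^sub>v x + b"
proof -
  have bc: "b \<in> carrier_vec n" using b by (auto simp: less_eq_vec_def)
  define N where "N = t \<cdot>\<^sub>m 1\<^sub>m n - M"
  have N: "N \<in> carrier_mat n n" using M unfolding N_def by (intro minus_carrier_mat) auto
  have Nx: "N *\<^sub>v x = t \<cdot>\<^sub>v x - M *\<^sub>v x" if x: "x \<in> carrier_vec n" for x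
    unfolding N_def using x M by (subst minus_mult_distrib_mat_vec[of _ n n]) auto
  have "det N \<noteq> 0"
  proof
    assume "det N = 0"
    then obtain v where v: "v \<in> carrier_vec n" "v \<noteq> 0\<^sub>v n" "N *\<^sub>v v = 0\<^sub>v n"
      using det_0_iff_vec_prod_zero_field[OF N] by blast
    have e: "(M *\<^sub>v v) $ i = t * v $ i" if "i < n" for i
    proof -
      have "(t \<cdot>\<^sub>v v - M *\<^sub>v v) $ i = 0" using that v Nx by simp
      then show ?thesis using that v M by simp
    qed
    have "0\<^sub>v n \<le> v"
      using e v M by (intro supersolution_nonneg[OF M t]) (auto simp: less_eq_vec_def simp del: index_mult_mat_vec)
    moreover have "0\<^sub>v n \<le> - v"
    proof (intro supersolution_nonneg[OF M t])
      have "(M *\<^sub>v - v) $ i = - ((M *\<^sub>v v) $ i)" if "i < n" for i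
        using that v M by simp
      then show "M *\<^sub>v - v \<le> t \<cdot>\<^sub>v - v"
        using e v M by (auto simp: less_eq_vec_def simp del: index_mult_mat_vec)
    qed (use v in simp)
    ultimately have "v = 0\<^sub>v n" using v by (intro eq_vecI) (auto simp: less_eq_vec_def intro: antisym)
    then show False using v by simp
  qed
  define x where "x = (1 / det N) \<cdot>\<^sub>v (adj_mat N *\<^sub>v b)"
  note adj = adj_mat[OF N]
  have xc: "x \<in> carrier_vec n" using adj bc by (simp add: x_def)
  have "N *\<^sub>v x = (1 / det N) \<cdot>\<^sub>v ((N * adj_mat N) *\<^sub>v b)"
    unfolding x_def assoc_mult_mat_vec[OF N adj(1) bc] using adj(1) bc by (simp add: mult_mat_vec[OF N])
  also have "\<dots> = b"
    unfolding adj using bc \<open>det N \<noteq> 0\<close> by (intro eq_vecI) auto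
  finally have eq: "t \<cdot>\<^sub>v x - M *\<^sub>v x = b" using Nx xc by simp
  have e: "(t \<cdot>\<^sub>v x) $ i = (M *\<^sub>v x) $ i + b $ i" if "i < n" for i
    using arg_cong[OF eq, of "\<lambda>w. w $ i"] that xc M by simp
  then have "t \<cdot>\<^sub>v x = M *\<^sub>v x + b" using xc M bc by (intro eq_vecI) auto
  moreover have "0\<^sub>v n \<le> x"
    using e b xc M
    by (intro supersolution_nonneg[OF M t xc]) (auto simp: less_eq_vec_def simp del: index_mult_mat_vec)
  ultimately show ?thesis using that by blast
qed

text \<open>Normalised solutions of \<open>t x = M x + 1\<close> accumulate, as \<open>t\<close> decreases to \<open>rho M\<close>, at some \<open>l\<close> with
  \<open>rho M * l = M l + e\<close>. A positive constant \<open>e\<close> is excluded by comparing \<open>l\<close> with the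
  modulus of an eigenvector for an eigenvalue of maximal modulus.\<close>
lemma perron_frobenius_weak:
  assumes M: "M \<in> carrier_mat n n" "nonneg_mat M" and n: "0 < n"
  obtains y where "0\<^sub>v n \<le> y" "y \<noteq> 0\<^sub>v n" "M *\<^sub>v y = rho M \<cdot>\<^sub>v y"
proof -
  \<comment> \<open>A strictly positive right-hand side forces \<open>1 \<le> t k * S k\<close> for
    the coordinate sums \<open>S k\<close> of the solutions. These can then be divided by, and
    \<open>1 / S k\<close> stays bounded.\<close>
  define one :: "real vec" where "one = vec n (\<lambda>_. 1)"
  define t where "t k = rho M + 1 / real (Suc k)" for k
  have r0: "0 \<le> rho M" using rho_nonneg[OF M(1) n] .
  have t: "rho M < t k" "0 < t k" "t k \<le> rho M + 1" for k using r0 by (auto simp: t_def add_nonneg_pos)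
  have t_lim: "t \<longlonglongrightarrow> rho M"
    using tendsto_add[OF tendsto_const LIMSEQ_inverse_real_of_nat, of "rho M"]
    by (simp add: t_def[abs_def] inverse_eq_divide)
  have "0\<^sub>v n \<le> one" by (simp add: one_def less_eq_vec_def)
  then have "\<exists>x. 0\<^sub>v n \<le> x \<and> t k \<cdot>\<^sub>v x = M *\<^sub>v x + one" for k
    using solvable_above_rho[OF M t(1)] by metis
  then obtain X where X: "\<And>k. 0\<^sub>v n \<le> X k" "\<And>k. t k \<cdot>\<^sub>v X k = M *\<^sub>v X k + one" by metis
  have Xc: "X k \<in> carrier_vec n" for k using X(1)[of k] by (auto simp: less_eq_vec_def)
  have Xi: "0 \<le> X k $ i" if "i < n" for k i using that X(1)[of k] by (auto simp: less_eq_vec_def)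
  have eq: "t k * X k $ i = (\<Sum>j<n. M $$ (i, j) * X k $ j) + 1" if i: "i < n" for k i
  proof -
    have "(t k \<cdot>\<^sub>v X k) $ i = (M *\<^sub>v X k + one) $ i" using X(2) by simp
    then show ?thesis
      using i M Xc[of k] index_mult_mat_vec_sum[OF M(1) Xc i]
      by (simp add: one_def del: index_mult_mat_vec)
  qed
  define S where "S k = (\<Sum>i<n. X k $ i)" for k
  have X_le_S: "X k $ i \<le> S k" if "i < n" for k i
    unfolding S_def using that Xi by (intro member_le_sum) auto
  have "0 \<le> (\<Sum>j<n. M $$ (0, j) * X k $ j)" for k
    using M n Xi by (intro sum_nonneg mult_nonneg_nonneg) (auto simp: nonneg_mat_def)
  then have "1 \<le> t k * X k $ 0" for k using eq[OF n] by simp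
  moreover have "t k * X k $ 0 \<le> t k * S k" for k
    using X_le_S[OF n, of k] t(2)[of k] by simp
  ultimately have tS: "1 \<le> t k * S k" for k using order_trans by blast
  have S: "0 < S k" for k
  proof -
    have "0 < t k * S k" using tS[of k] by linarith
    then show ?thesis using t(2)[of k] by (simp add: zero_less_mult_iff)
  qed
  \<comment> \<open>Coordinate \<open>n\<close> carries the normalised right-hand side
    \<open>1 / S k\<close>, so that one subsequence serves it together with the vector. Its limit
    \<open>l n\<close> is the constant to be excluded. The common bound \<open>rho M + 1\<close>
    covers both the entries, at most 1, and \<open>1 / S k \<le> t k\<close>.\<close>
  define f where "f k i = (if i < n then X k $ i / S k else 1 / S k)" for k i
  have "\<bar>f k i\<bar> \<le> rho M + 1" for k i
  proof (cases "i < n")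
    case True
    then have "\<bar>f k i\<bar> \<le> 1" using Xi[OF True, of k] X_le_S[OF True, of k] S[of k] by (simp add: f_def)
    then show ?thesis using r0 by simp
  next
    case False
    have "1 / S k \<le> t k" using tS[of k] S[of k] by (simp add: field_simps)
    then show ?thesis using t(3)[of k] S[of k] False by (simp add: f_def)
  qed
  then obtain q l where q: "strict_mono q"
    and l: "\<And>i. i < Suc n \<Longrightarrow> (\<lambda>k. f (q k) i) \<longlonglongrightarrow> l i"
    using bounded_convergent_subseq[of "Suc n" f "rho M + 1"] by blast
  have f0: "0 \<le> f k i" for k i using Xi S[of k] by (simp add: f_def)
  have l0: "0 \<le> l i" if "i < Suc n" for i
    using LIMSEQ_le_const[OF l[OF that]] f0 by blast
  \<comment> \<open>The normalisation to coordinate sum 1 survives the limit, which keeps the limit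
    vector from vanishing.\<close>
  have "(\<lambda>k. \<Sum>i<n. f (q k) i) \<longlonglongrightarrow> (\<Sum>i<n. l i)" by (intro tendsto_sum l) auto
  moreover have "(\<Sum>i<n. f k i) = 1" for k
  proof -
    have "(\<Sum>i<n. f k i) = S k / S k" unfolding S_def sum_divide_distrib by (simp add: f_def S_def)
    then show ?thesis using S[of k] by simp
  qed
  ultimately have l1: "(\<Sum>i<n. l i) = 1" by (simp add: LIMSEQ_const_iff)
  have leq: "rho M * l i = (\<Sum>j<n. M $$ (i, j) * l j) + l n" if i: "i < n" for i
  proof -
    have f_eq: "t k * f k i = (\<Sum>j<n. M $$ (i, j) * f k j) + f k n" for k
      using eq[OF i, of k] S[of k] i
      by (simp add: f_def field_simps sum_divide_distrib[symmetric] flip: sum_distrib_left)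
    have "(\<lambda>k. t (q k) * f (q k) i) \<longlonglongrightarrow> rho M * l i"
      using i l LIMSEQ_subseq_LIMSEQ[OF t_lim q] by (intro tendsto_mult) (auto simp: o_def)
    moreover have "(\<lambda>k. t (q k) * f (q k) i)
        \<longlonglongrightarrow> (\<Sum>j<n. M $$ (i, j) * l j) + l n"
      unfolding f_eq by (intro tendsto_intros l) auto
    ultimately show ?thesis by (rule LIMSEQ_unique)
  qed
  have ln: "l n = 0"
  proof (rule ccontr)
    assume "l n \<noteq> 0"
    then have e: "0 < l n" using l0[of n] by simp
    obtain u where u: "0\<^sub>v n \<le> u" "u \<noteq> 0\<^sub>v n" "rho M \<cdot>\<^sub>v u \<le> M *\<^sub>v u"
      using rho_subeigenvector[OF M n] .
    have uc: "u \<in> carrier_vec n" using u(1) by (auto simp: less_eq_vec_def)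
    have u0: "0 \<le> u $ i" if "i < n" for i using that u(1) by (auto simp: less_eq_vec_def)
    have lpos: "0 < l i" if i: "i < n" for i
    proof -
      have "0 \<le> (\<Sum>j<n. M $$ (i, j) * l j)"
        using M l0 i by (intro sum_nonneg mult_nonneg_nonneg) (auto simp: nonneg_mat_def)
      then have "0 < rho M * l i" using leq[OF i] e by simp
      then show ?thesis using r0 by (simp add: zero_less_mult_iff)
    qed
    \<comment> \<open>The least factor with u <= c l, available since a positive \<open>l n\<close>
      makes all \<open>l i\<close> positive. In a row \<open>i\<close> where it is attained, the
      subeigenvector inequality for \<open>u\<close> and the equation for \<open>l\<close> leave
      \<open>c * l n \<le> 0\<close>, which kills \<open>u\<close>.\<close>
    define c where "c = Max ((\<lambda>i. u $ i / l i) ` {..<n})"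
    have "c \<in> (\<lambda>i. u $ i / l i) ` {..<n}" unfolding c_def using n by (intro Max_in) auto
    then obtain i where i: "i < n" "c = u $ i / l i" by auto
    have ule: "u $ j \<le> c * l j" if "j < n" for j
    proof -
      have "u $ j / l j \<le> c" unfolding c_def using that by (intro Max_ge) auto
      then show ?thesis using lpos[OF that] by (simp add: field_simps)
    qed
    have "rho M * u $ i \<le> (M *\<^sub>v u) $ i" using u(3) i uc M by (simp add: less_eq_vec_def)
    also have "\<dots> = (\<Sum>j<n. M $$ (i, j) * u $ j)" using index_mult_mat_vec_sum[OF M(1) uc i(1)] .
    also have "\<dots> \<le> (\<Sum>j<n. M $$ (i, j) * (c * l j))"
      using M i ule by (intro sum_mono mult_left_mono) (auto simp: nonneg_mat_def)
    also have "\<dots> = c * (\<Sum>j<n. M $$ (i, j) * l j)" by (simp add: sum_distrib_left mult_ac)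
    also have "\<dots> = c * (rho M * l i - l n)" using leq[OF i(1)] by simp
    also have "\<dots> = rho M * u $ i - c * l n" using i lpos[OF i(1)] by (simp add: field_simps)
    finally have "c * l n \<le> 0" by simp
    then have "c \<le> 0" using e by (simp add: mult_le_0_iff)
    then have "u $ j = 0" if "j < n" for j
      using ule[OF that] u0[OF that] lpos[OF that] mult_nonpos_nonneg[of c "l j"] by linarith
    then show False using u(2) uc by (metis carrier_vecD eq_vecI index_zero_vec)
  qed
  define y where "y = vec n l"
  have "0\<^sub>v n \<le> y" using l0 by (simp add: y_def less_eq_vec_def)
  moreover have "y \<noteq> 0\<^sub>v n"
  proof
    assume "y = 0\<^sub>v n"
    then have "l i = 0" if "i < n" for i using that unfolding y_def by (metis index_vec index_zero_vec(1))
    then show False using l1 by simp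
  qed
  moreover have "M *\<^sub>v y = rho M \<cdot>\<^sub>v y"
  proof (rule eq_vecI)
    fix i assume "i < dim_vec (rho M \<cdot>\<^sub>v y)"
    then have i: "i < n" by (simp add: y_def)
    show "(M *\<^sub>v y) $ i = (rho M \<cdot>\<^sub>v y) $ i"
      using leq[OF i] ln i index_mult_mat_vec_sum[OF M(1) _ i, of y] by (simp add: y_def del: index_mult_mat_vec)
  qed (use M in \<open>simp add: y_def\<close>)
  ultimately show ?thesis using that by blast
qed

section \<open>The Moore-Penrose inverse\<close>

text \<open>Wedderburn's rank reduction: subtracting \<open>A X A\<close>, with \<open>X\<close> supported on one entry, clears
  a row of \<open>A\<close>, and by McCoy's lemma \<open>A\<close> has an inner inverse as soon as \<open>A - A X A\<close> has one.\<close>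
lemma ex_inner_inverse:
  fixes A :: "'a :: field mat"
  assumes "A \<in> carrier_mat m n"
  obtains G where "G \<in> carrier_mat n m" "A * G * A = A"
proof -
  have "\<exists>G \<in> carrier_mat n m. A * G * A = A"
    using assms
  \<comment> \<open>The number of nonzero rows decreases: the pivot row is cleared, and a zero row
    of \<open>A\<close> remains zero in the reduced matrix.\<close>
  proof (induction "card {k. k < m \<and> row A k \<noteq> 0\<^sub>v n}" arbitrary: A rule: less_induct)
    case less
    note A = \<open>A \<in> carrier_mat m n\<close>
    show ?case
    proof (cases "A = 0\<^sub>m m n")
      case True
      then show ?thesis by (intro bexI[of _ "0\<^sub>m n m"]) auto
    next
      case False
      then obtain i j where ij: "i < m" "j < n" "A $$ (i, j) \<noteq> 0"
        using A by (metis carrier_matD eq_matI index_zero_mat)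
      \<comment> \<open>With this single entry, A X A is column \<open>j\<close> times row
        \<open>i\<close> divided by the pivot, a rank-one matrix that agrees with \<open>A\<close>
        on row \<open>i\<close>.\<close>
      define X where "X = mat n m (\<lambda>(k, l). if k = j \<and> l = i then 1 / A $$ (i, j) else 0)"
      have X: "X \<in> carrier_mat n m" by (simp add: X_def)
      have XA: "(X * A) $$ (k, l) = (if k = j then A $$ (i, l) / A $$ (i, j) else 0)"
        if "k < n" "l < n" for k l
        using that ij A
        by (auto simp: X_def scalar_prod_def if_distrib[of "\<lambda>x. x * _"] sum.delta cong: if_cong)
      have AXA: "(A * (X * A)) $$ (k, l) = A $$ (k, j) * A $$ (i, l) / A $$ (i, j)"
        if "k < m" "l < n" for k l
      proof -
        have "(A * (X * A)) $$ (k, l) = (\<Sum>p<n. A $$ (k, p) * (X * A) $$ (p, l))"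
          using that A X by (simp add: scalar_prod_def atLeast0LessThan)
        also have "\<dots> = (\<Sum>p<n. if p = j then A $$ (k, j) * A $$ (i, l) / A $$ (i, j) else 0)"
          using XA that by (intro sum.cong) (auto simp del: index_mult_mat)
        also have "\<dots> = A $$ (k, j) * A $$ (i, l) / A $$ (i, j)" using ij by simp
        finally show ?thesis .
      qed
      define B where "B = A - A * (X * A)"
      have B: "B \<in> carrier_mat m n"
        unfolding B_def by (rule minus_carrier_mat[OF mult_carrier_mat[OF A mult_carrier_mat[OF X A]]])
      have Bkl: "B $$ (k, l) = A $$ (k, l) - A $$ (k, j) * A $$ (i, l) / A $$ (i, j)"
        if "k < m" "l < n" for k l
        using that AXA A X by (simp add: B_def del: index_mult_mat(1))
      have row_i: "row B i = 0\<^sub>v n" "row A i \<noteq> 0\<^sub>v n"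
      proof -
        show "row B i = 0\<^sub>v n" using ij B Bkl by (intro eq_vecI) auto
        show "row A i \<noteq> 0\<^sub>v n" using ij A by (metis carrier_matD index_row(1) index_zero_vec(1))
      qed
      have "row B k = 0\<^sub>v n" if k: "k < m" "row A k = 0\<^sub>v n" for k
      proof -
        have "A $$ (k, l) = 0" if "l < n" for l
          using k that A by (metis carrier_matD index_row(1) index_zero_vec(1))
        then show ?thesis using k ij B Bkl by (intro eq_vecI) auto
      qed
      then have "{k. k < m \<and> row B k \<noteq> 0\<^sub>v n} \<subset> {k. k < m \<and> row A k \<noteq> 0\<^sub>v n}"
        using row_i ij(1) by blast
      then obtain G where G: "G \<in> carrier_mat n m" "B * G * B = B"
        using less.hyps[OF _ B] psubset_card_mono[of "{k. k < m \<and> row A k \<noteq> 0\<^sub>v n}"] by auto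
      \<comment> \<open>McCoy's formula. Each of the two outer factors turns \<open>A\<close> into
        \<open>B\<close>, so that A H A = A X A + B G B, and B G B = B = A - A X A.\<close>
      define H where "H = X + (1\<^sub>m n - X * A) * (G * (1\<^sub>m m - A * X))"
      have l: "A * (1\<^sub>m n - X * A) = B"
        unfolding B_def using A X by (subst mult_minus_distrib_mat[of _ m n]) auto
      have r: "(1\<^sub>m m - A * X) * A = B"
        unfolding B_def using A X
        by (subst minus_mult_distrib_mat[of _ m m]) (auto simp: assoc_mult_mat[of _ m n _ m _ n])
      have c: "1\<^sub>m n - X * A \<in> carrier_mat n n" "1\<^sub>m m - A * X \<in> carrier_mat m m" using A X by auto
      have H: "H \<in> carrier_mat n m" using X G c by (auto simp: H_def)
      have "A * H = A * X + B * (G * (1\<^sub>m m - A * X))"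
        unfolding H_def using A X G c
        by (subst mult_add_distrib_mat[of _ m n]) (auto simp: l assoc_mult_mat[of _ m n _ n _ m, symmetric])
      then have "A * H * A = A * X * A + B * (G * (1\<^sub>m m - A * X)) * A"
        using A X B G c by (simp add: add_mult_distrib_mat[of _ m m])
      also have "B * (G * (1\<^sub>m m - A * X)) * A = B * G * B"
        using A X B G c by (simp add: r assoc_mult_mat[of _ m n _ m _ m] assoc_mult_mat[of _ m n _ m _ n]
           assoc_mult_mat[of _ n m _ m _ n])
      also have "\<dots> = A - A * X * A"
            unfolding G(2) unfolding B_def using A X by (simp add: assoc_mult_mat[of _ m n _ m _ n])
      also have "A * X * A + (A - A * X * A) = A"
        using A X by (intro eq_matI) auto
      finally show ?thesis using H by blast
    qed
  qed
  then show ?thesis using that by blast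
qed

text \<open>The diagonal entries of the product are the sums of squares of the columns of
  \<open>D\<close>.\<close>

lemma transpose_mult_self_eq_0:
  fixes D :: "real mat"
  assumes D: "D \<in> carrier_mat m k" and eq: "transpose_mat D * D = 0\<^sub>m k k"
  shows "D = 0\<^sub>m m k"
proof (rule eq_matI)
  fix i j assume "i < dim_row (0\<^sub>m m k :: real mat)" "j < dim_col (0\<^sub>m m k :: real mat)"
  then have ij: "i < m" "j < k" by auto
  have "(\<Sum>l<m. (D $$ (l, j))\<^sup>2) = (transpose_mat D * D) $$ (j, j)"
    using D ij by (simp add: scalar_prod_def atLeast0LessThan power2_eq_square)
  then have "(\<Sum>l<m. (D $$ (l, j))\<^sup>2) = 0" using eq ij by simp
  then have "(D $$ (i, j))\<^sup>2 = 0" using ij by (subst (asm) sum_nonneg_eq_0_iff) auto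
  then show "D $$ (i, j) = 0\<^sub>m m k $$ (i, j)" using ij by simp
qed (use D in auto)

text \<open>This cancels the transpose on the left: multiplying by the transpose of \<open>C\<close>
  produces the Gram matrix of \<open>A * C\<close>.\<close>

lemma gram_mult_eq_0:
  fixes A :: "real mat"
  assumes A: "A \<in> carrier_mat m n" and C: "C \<in> carrier_mat n k"
    and eq: "transpose_mat A * A * C = 0\<^sub>m n k"
  shows "A * C = 0\<^sub>m m k"
proof (rule transpose_mult_self_eq_0)
  show "A * C \<in> carrier_mat m k" using A C by simp
  have "transpose_mat (A * C) * (A * C) = transpose_mat C * (transpose_mat A * A * C)"
    using A C by (simp add: transpose_mult[OF A C] assoc_mult_mat[of _ k n _ m _ k]
      assoc_mult_mat[of _ n m _ n _ k])
  also have "\<dots> = 0\<^sub>m k k" using C by (simp add: eq)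
  finally show "transpose_mat (A * C) * (A * C) = 0\<^sub>m k k" .
qed

text \<open>The witness is G A^T, where G is an inner inverse of the Gram matrix A^T A. Cancelling
  A^T in A^T A Y A = A^T A gives A Y A = A. Transposing this gives A^T = A^T (A Y)^T, hence A Y = (A
  Y)(A Y)^T, which is symmetric.\<close>

lemma ex_least_squares_inverse:
  fixes A :: "real mat"
  assumes A: "A \<in> carrier_mat m n"
  obtains Y where "Y \<in> carrier_mat n m" "A * Y * A = A" "transpose_mat (A * Y) = A * Y"
proof -
  let ?T = "transpose_mat A"
  have T: "?T \<in> carrier_mat n m" using A by simp
  have S: "?T * A \<in> carrier_mat n n" using A by simp
  obtain G where G: "G \<in> carrier_mat n n" "?T * A * G * (?T * A) = ?T * A"
    using ex_inner_inverse[OF S] .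
  define Y where "Y = G * ?T"
  have Y: "Y \<in> carrier_mat n m" using G T by (simp add: Y_def)
  have "?T * A * (Y * A - 1\<^sub>m n) = ?T * A * (Y * A) - ?T * A"
    using S Y A by (subst mult_minus_distrib_mat[of _ n n]) auto
  also have "?T * A * (Y * A) = ?T * A * G * (?T * A)"
    unfolding Y_def assoc_mult_mat[OF G(1) T A] assoc_mult_mat[OF S G(1) S] ..
  finally have "?T * A * (Y * A - 1\<^sub>m n) = 0\<^sub>m n n" unfolding G(2) using S by auto
  then have "A * (Y * A - 1\<^sub>m n) = 0\<^sub>m m n" 
    by (rule gram_mult_eq_0[OF A minus_carrier_mat[OF one_carrier_mat]])
  then have "A * (Y * A) - A = 0\<^sub>m m n"
    using A Y by (subst (asm) mult_minus_distrib_mat[of _ m n]) auto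
  have AYA: "A * Y * A = A"
  proof (rule eq_matI)
    fix i j assume ij: "i < dim_row A" "j < dim_col A"
    have "(A * (Y * A) - A) $$ (i, j) = 0"
      using \<open>A * (Y * A) - A = 0\<^sub>m m n\<close> ij A by simp
    then have "(A * (Y * A)) $$ (i, j) = A $$ (i, j)" using ij A Y by (simp del: index_mult_mat(1))
    then show "(A * Y * A) $$ (i, j) = A $$ (i, j)"
      using A Y by (simp add: assoc_mult_mat[of _ m n _ m _ n])
  qed (use A Y in auto)
  have AY: "A * Y \<in> carrier_mat m m" using A Y by simp
  have TY: "?T * transpose_mat (A * Y) = ?T"
    using arg_cong[OF AYA, of transpose_mat] transpose_mult[OF AY A] by simp
  have "A * Y = A * G * ?T" unfolding Y_def using A G T by (simp add: assoc_mult_mat[of _ m n _ n _ m])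
  also have "\<dots> = A * G * (?T * transpose_mat (A * Y))" by (simp add: TY)
  also have "\<dots> = A * Y * transpose_mat (A * Y)"
    using A G T AY unfolding Y_def by (simp add: assoc_mult_mat[of _ m n _ n _ m] assoc_mult_mat[of _ n n _ m _ m]
       assoc_mult_mat[of _ m n _ m _ m] assoc_mult_mat[of _ m n _ n _ m])
  finally have e: "A * Y = A * Y * transpose_mat (A * Y)" .
  have "transpose_mat (A * Y) = transpose_mat (A * Y * transpose_mat (A * Y))" using e by simp
  also have "\<dots> = A * Y * transpose_mat (A * Y)"
    using AY by (subst transpose_mult[OF AY]) auto
  finally have "transpose_mat (A * Y) = A * Y" using e by simp
  then show ?thesis using that Y AYA by blast
qed

text \<open>Transposing \<open>P * Q = P\<close> gives \<open>Q * P = P\<close>. This form is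
  applied to projections with a common null space, the primed one to projections with a common
  range.\<close>

lemma symmetric_eq_if_absorb:
  assumes P: "P \<in> carrier_mat n n" "transpose_mat P = P" and Q: "Q \<in> carrier_mat n n" "transpose_mat Q = Q"
    and "P * Q = P" "Q * P = (Q :: 'a :: comm_semiring_0 mat)"
  shows "P = Q"
  using transpose_mult[OF P(1) Q(1)] assms by simp

lemma symmetric_eq_if_absorb':
  assumes P: "P \<in> carrier_mat n n" "transpose_mat P = P" and Q: "Q \<in> carrier_mat n n" "transpose_mat Q = Q"
    and "P * Q = Q" "Q * P = (P :: 'a :: comm_semiring_0 mat)"
  shows "P = Q"
  using transpose_mult[OF P(1) Q(1)] assms by simp

text \<open>The predicate under the definite description in \<open>mp_inverse\<close>, named so that
  existence and uniqueness can be treated separately.\<close>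

definition penrose :: "real mat \<Rightarrow> real mat \<Rightarrow> bool" where
  "penrose M X \<longleftrightarrow> X \<in> carrier_mat (dim_col M) (dim_row M)
      \<and> M * X * M = M \<and> X * M * X = X
      \<and> transpose_mat (M * X) = M * X \<and> transpose_mat (X * M) = X * M"

text \<open>The products M X and M Y are symmetric and absorb each other, hence coincide, and
  likewise X M and Y M. Then X = X M X = Y M X = Y M Y = Y.\<close>

lemma penrose_unique:
  assumes "penrose M X" "penrose M Y"
  shows "X = Y"
proof -
  obtain m n where M: "M \<in> carrier_mat m n" by blast
  have X: "X \<in> carrier_mat n m" and Y: "Y \<in> carrier_mat n m"
    using assms M by (auto simp: penrose_def)
  have "M * X = M * Y"
  proof (rule symmetric_eq_if_absorb'[of _ m])
    show "M * X * (M * Y) = M * Y"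
      using assms X Y M by (simp add: penrose_def flip: assoc_mult_mat[of _ m m _ n _ m])
    show "M * Y * (M * X) = M * X"
      using assms X Y M by (simp add: penrose_def flip: assoc_mult_mat[of _ m m _ n _ m])
  qed (use assms X Y M in \<open>auto simp: penrose_def\<close>)
  have "X * M = Y * M"
  proof (rule symmetric_eq_if_absorb[of _ n])
    show "X * M * (Y * M) = X * M"
      using assms X Y M by (simp add: penrose_def assoc_mult_mat[OF X M, of "Y * M" n])
    show "Y * M * (X * M) = Y * M"
      using assms X Y M by (simp add: penrose_def assoc_mult_mat[OF Y M, of "X * M" n])
  qed (use assms X Y M in \<open>auto simp: penrose_def\<close>)
  have "X = X * M * X" using assms by (simp add: penrose_def)
  also have "\<dots> = Y * (M * X)" using X Y M \<open>X * M = Y * M\<close> by simp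
  also have "\<dots> = Y" using assms X Y M \<open>M * X = M * Y\<close> by (simp add: penrose_def)
  finally show ?thesis .
qed

text \<open>Urquhart's formula Z A Y: here \<open>Y\<close> is an inner inverse with A Y symmetric,
  and \<open>Z\<close> is one with Z A symmetric, obtained by transposing a least-squares inverse of
  the transpose of \<open>A\<close>.\<close>

lemma ex_penrose: "\<exists>X. penrose A X"
proof -
  obtain m n where A: "A \<in> carrier_mat m n" by blast
  obtain Y where Y: "Y \<in> carrier_mat n m" "A * Y * A = A" "transpose_mat (A * Y) = A * Y"
    using ex_least_squares_inverse[OF A] .
  have T: "transpose_mat A \<in> carrier_mat n m" using A by simp
  obtain W where W: "W \<in> carrier_mat m n" "transpose_mat A * W * transpose_mat A = transpose_mat A"
      "transpose_mat (transpose_mat A * W) = transpose_mat A * W"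
    using ex_least_squares_inverse[OF T] .
  define Z where "Z = transpose_mat W"
  have Z: "Z \<in> carrier_mat n m" using W by (simp add: Z_def)
  have TW: "transpose_mat A * W = Z * A"
    using W(3) transpose_mult[OF T W(1)] by (simp add: Z_def)
  have ZA: "transpose_mat (Z * A) = Z * A" using W(3) TW by simp
  have "transpose_mat (Z * A * transpose_mat A) = transpose_mat (transpose_mat A)" using W(2) TW by simp
  then have AZA: "A * (Z * A) = A"
    using transpose_mult[of "Z * A" n n "transpose_mat A" m] Z A T ZA by simp
  define X where "X = Z * (A * Y)"
  have X: "X \<in> carrier_mat n m" using Z A Y by (simp add: X_def)
  have "A * X = A * (Z * A) * Y"
    unfolding X_def using A Z Y(1) by (simp add: assoc_mult_mat[OF A _ Y(1), of "Z * A"])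
  then have AX: "A * X = A * Y" by (simp add: AZA)
  have XA: "X * A = Z * A" unfolding X_def using A Z Y(1,2) by (simp add: assoc_mult_mat[OF Z _ A, of "A * Y"])
  have "X * A * X = Z * (A * X)" unfolding XA using A X Z by (intro assoc_mult_mat) auto
  also have "\<dots> = X" unfolding AX by (simp add: X_def)
  finally have "X * A * X = X" .
  then have "penrose A X" using A X AX XA Y ZA by (simp add: penrose_def)
  then show ?thesis ..
qed

lemma penrose_mp_inverse: "penrose M (mp_inverse M)"
proof -
  have "\<exists>!X. penrose M X" using ex_penrose penrose_unique by blast
  then have "penrose M (THE X. penrose M X)" by (rule theI')
  then show ?thesis by (simp add: mp_inverse_def penrose_def)
qed

lemma mp_inverse:
  assumes "M \<in> carrier_mat m n"
  shows "mp_inverse M \<in> carrier_mat n m"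
    and "M * mp_inverse M * M = M"
    and "mp_inverse M * M * mp_inverse M = mp_inverse M"
    and "transpose_mat (M * mp_inverse M) = M * mp_inverse M"
    and "transpose_mat (mp_inverse M * M) = mp_inverse M * M"
  using penrose_mp_inverse[of M] assms by (auto simp: penrose_def)

section \<open>Projections determined by the range and the null space\<close>

lemma eq_mat_if_mult_vec_eq:
  fixes A B :: "'a :: semiring_1 mat"
  assumes A: "A \<in> carrier_mat m n" and B: "B \<in> carrier_mat m n"
    and eq: "\<And>v. v \<in> carrier_vec n \<Longrightarrow> A *\<^sub>v v = B *\<^sub>v v"
  shows "A = B"
proof (rule eq_matI)
  fix i j assume "i < dim_row B" "j < dim_col B"
  then have ij: "i < m" "j < n" using B by auto
  have "(A *\<^sub>v unit_vec n j) $ i = (B *\<^sub>v unit_vec n j) $ i" using eq by simp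
  then show "A $$ (i, j) = B $$ (i, j)" using ij A B by simp
qed (use A B in auto)

lemma mp_inverse_range_absorb:
  assumes A: "A \<in> carrier_mat m n" and B: "B \<in> carrier_mat m k" and sub: "range_mat B \<subseteq> range_mat A"
  shows "A * mp_inverse A * B = B"
proof (rule eq_mat_if_mult_vec_eq[of _ m k])
  note mp = mp_inverse[OF A]
  fix v :: "real vec" assume v: "v \<in> carrier_vec k"
  then have "B *\<^sub>v v \<in> range_mat A" using sub B by (auto simp: range_mat_def)
  then obtain x where x: "x \<in> carrier_vec n" "B *\<^sub>v v = A *\<^sub>v x" using A by (auto simp: range_mat_def)
  have "A * mp_inverse A * B *\<^sub>v v = A * mp_inverse A *\<^sub>v (A *\<^sub>v x)"
    unfolding x(2)[symmetric] using A B mp(1) v by (intro assoc_mult_mat_vec[of _ m m _ k]) auto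
  also have "\<dots> = (A * mp_inverse A * A) *\<^sub>v x"
    using A mp(1) x(1) by (intro assoc_mult_mat_vec[symmetric, of _ m m _ n]) auto
  finally show "A * mp_inverse A * B *\<^sub>v v = B *\<^sub>v v" using mp(2) x(2) by simp
qed (use mp_inverse[OF A] A B in auto)

text \<open>The difference between a vector and its projection under A^+ A lies in the null space of
  \<open>A\<close>, so \<open>B\<close> annihilates it as well.\<close>

lemma mp_inverse_null_absorb:
  assumes A: "A \<in> carrier_mat m n" and B: "B \<in> carrier_mat k n" and sub: "null_mat A \<subseteq> null_mat B"
  shows "B * (mp_inverse A * A) = B"
proof (rule eq_mat_if_mult_vec_eq[of _ k n])
  note mp = mp_inverse[OF A]
  have P: "mp_inverse A * A \<in> carrier_mat n n" using mp A by simp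
  fix v :: "real vec" assume v: "v \<in> carrier_vec n"
  define w where "w = v - (mp_inverse A * A) *\<^sub>v v"
  have w: "w \<in> carrier_vec n" using v P by (simp add: w_def)
  have "A *\<^sub>v w = A *\<^sub>v v - A *\<^sub>v ((mp_inverse A * A) *\<^sub>v v)"
    unfolding w_def using A P v by (intro mult_minus_distrib_mat_vec) auto
  also have "A *\<^sub>v ((mp_inverse A * A) *\<^sub>v v) = (A * mp_inverse A * A) *\<^sub>v v"
    using A P v mp(1) by (simp add: assoc_mult_mat[of _ m n _ m _ n] assoc_mult_mat_vec[of _ m n _ n])
  finally have "A *\<^sub>v w = 0\<^sub>v m" using mp(2) A v by simp
  then have "B *\<^sub>v w = 0\<^sub>v k" using sub w A B by (auto simp: null_mat_def)
  moreover have "B *\<^sub>v w = B *\<^sub>v v - B *\<^sub>v ((mp_inverse A * A) *\<^sub>v v)"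
    unfolding w_def using B P v by (intro mult_minus_distrib_mat_vec) auto
  ultimately have "B *\<^sub>v ((mp_inverse A * A) *\<^sub>v v) = B *\<^sub>v v"
    using B v P by (smt (verit) carrier_vecD eq_iff_diff_eq_0 eq_vecI index_minus_vec(1) index_zero_vec(1) mult_mat_vec_carrier)
  then show "B * (mp_inverse A * A) *\<^sub>v v = B *\<^sub>v v" using B P v by (simp add: assoc_mult_mat_vec[of _ k n _ n])
qed (use mp_inverse[OF A] A B in auto)

text \<open>Both products are symmetric, and each fixes the range of the other. With its counterpart
  for null spaces, this turns the two conditions of a proper splitting into identities between
  products.\<close>

lemma mp_inverse_range_eq:
  assumes A: "A \<in> carrier_mat m n" and B: "B \<in> carrier_mat m k" and eq: "range_mat A = range_mat B"
  shows "A * mp_inverse A = B * mp_inverse B"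
proof (rule symmetric_eq_if_absorb'[of _ m])
  note mA = mp_inverse[OF A] and mB = mp_inverse[OF B]
  show "A * mp_inverse A * (B * mp_inverse B) = B * mp_inverse B"
    using A B mA(1) mB(1) mp_inverse_range_absorb[OF A B] eq
    by (simp flip: assoc_mult_mat[of _ m m _ k _ m])
  show "B * mp_inverse B * (A * mp_inverse A) = A * mp_inverse A"
    using A B mA(1) mB(1) mp_inverse_range_absorb[OF B A] eq
    by (simp flip: assoc_mult_mat[of _ m m _ n _ m])
qed (use mp_inverse[OF A] mp_inverse[OF B] A B in auto)

lemma mp_inverse_null_eq:
  assumes A: "A \<in> carrier_mat m n" and B: "B \<in> carrier_mat k n" and eq: "null_mat A = null_mat B"
  shows "mp_inverse A * A = mp_inverse B * B"
proof (rule symmetric_eq_if_absorb[of _ n])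
  note mA = mp_inverse[OF A] and mB = mp_inverse[OF B]
  show "mp_inverse A * A * (mp_inverse B * B) = mp_inverse A * A"
    using A B mA(1) mB(1) mp_inverse_null_absorb[OF B A] eq
    by (simp add: assoc_mult_mat[of _ n m _ n _ n])
  show "mp_inverse B * B * (mp_inverse A * A) = mp_inverse B * B"
    using A B mA(1) mB(1) mp_inverse_null_absorb[OF A B] eq
    by (simp add: assoc_mult_mat[of _ n k _ n _ n])
qed (use mp_inverse[OF A] mp_inverse[OF B] A B in auto)

section \<open>Companion matrices and double proper splittings\<close>

text \<open>The block companion matrix of the quadratic pencil l^2 I - l U - V. Being input only, it
  leaves the block form of the statement visible.\<close>

abbreviation (input) companion_mat :: "real mat \<Rightarrow> real mat \<Rightarrow> nat \<Rightarrow> real mat" where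
  "companion_mat U V n \<equiv> four_block_mat U V (1\<^sub>m n) (0\<^sub>m n n)"

lemma companion_mat_mult_vec:
  assumes "U \<in> carrier_mat n n" "V \<in> carrier_mat n n" "a \<in> carrier_vec n" "b \<in> carrier_vec n"
  shows "companion_mat U V n *\<^sub>v (a @\<^sub>v b) = (U *\<^sub>v a + V *\<^sub>v b) @\<^sub>v a"
proof -
  have "0\<^sub>m n n *\<^sub>v b = 0\<^sub>v n" using assms(4) by (intro eq_vecI) auto
  then show ?thesis
    using assms four_block_mat_mult_vec[OF assms(1,2) one_carrier_mat zero_carrier_mat assms(3,4)] by simp
qed

lemma companion_mat_carrier [simp]:
  "U \<in> carrier_mat n n \<Longrightarrow> companion_mat U V n \<in> carrier_mat (n + n) (n + n)"
  by (simp add: four_block_carrier_mat)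

lemma nonneg_companion_mat:
  assumes "U \<in> carrier_mat n n" "V \<in> carrier_mat n n" "nonneg_mat U" "nonneg_mat V"
  shows "nonneg_mat (companion_mat U V n)"
  using assms by (auto simp: nonneg_mat_def)

text \<open>The second block row makes the upper half of an eigenvector equal to l times the lower
  half \<open>y\<close>; the first row then becomes the quadratic equation. For the same reason
  \<open>y = 0\<close> would annihilate the whole vector.\<close>

lemma companion_mat_perron_vector:
  assumes U: "U \<in> carrier_mat n n" "nonneg_mat U" and V: "V \<in> carrier_mat n n" "nonneg_mat V" and n: "0 < n"
    and l: "l = rho (companion_mat U V n)" "0 < l"
  obtains y where "0\<^sub>v n \<le> y" "y \<noteq> 0\<^sub>v n" "l \<cdot>\<^sub>v (U *\<^sub>v y) + V *\<^sub>v y = l\<^sup>2 \<cdot>\<^sub>v y"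
proof -
  have T: "companion_mat U V n \<in> carrier_mat (n + n) (n + n)" "nonneg_mat (companion_mat U V n)"
    using U V nonneg_companion_mat by simp_all
  obtain z where z: "0\<^sub>v (n + n) \<le> z" "z \<noteq> 0\<^sub>v (n + n)" "companion_mat U V n *\<^sub>v z = l \<cdot>\<^sub>v z"
    using perron_frobenius_weak[OF T] n l(1) by auto
  have zc: "z \<in> carrier_vec (n + n)" using z(1) by (auto simp: less_eq_vec_def)
  define x y where "x = vec_first z n" and "y = vec_last z n"
  have c: "x \<in> carrier_vec n" "y \<in> carrier_vec n" by (simp_all add: x_def y_def)
  have zxy: "z = x @\<^sub>v y" using zc by (simp add: x_def y_def)
  have "(U *\<^sub>v x + V *\<^sub>v y) @\<^sub>v x = (l \<cdot>\<^sub>v x) @\<^sub>v (l \<cdot>\<^sub>v y)"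
  proof -
    have "l \<cdot>\<^sub>v (x @\<^sub>v y) = (l \<cdot>\<^sub>v x) @\<^sub>v (l \<cdot>\<^sub>v y)" by (intro eq_vecI) auto
    then show ?thesis using z(3) companion_mat_mult_vec[OF U(1) V(1) c] unfolding zxy by simp
  qed
  then have eq: "U *\<^sub>v x + V *\<^sub>v y = l \<cdot>\<^sub>v x" "x = l \<cdot>\<^sub>v y"
    using append_vec_eq[of "U *\<^sub>v x + V *\<^sub>v y" n "l \<cdot>\<^sub>v x"] U V c by auto
  have zero: "(0\<^sub>v (n + n) :: real vec) = 0\<^sub>v n @\<^sub>v 0\<^sub>v n" by (intro eq_vecI) auto
  have "0\<^sub>v n \<le> y" using z(1) unfolding zxy zero using append_vec_le[of "0\<^sub>v n" n x] c by simp
  moreover have "y \<noteq> 0\<^sub>v n"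
  proof
    assume "y = 0\<^sub>v n"
    then have "x = 0\<^sub>v n" using eq(2) by (intro eq_vecI) auto
    then show False using z(2) \<open>y = 0\<^sub>v n\<close> zero zxy by simp
  qed
  moreover have "l \<cdot>\<^sub>v (U *\<^sub>v y) + V *\<^sub>v y = l\<^sup>2 \<cdot>\<^sub>v y"
    using eq(1) c U unfolding eq(2) by (simp add: mult_mat_vec[OF U(1)] smult_smult_assoc power2_eq_square)
  ultimately show ?thesis using that by blast
qed

lemma nonneg_vec_carrier: "0\<^sub>v n \<le> (v :: real vec) \<Longrightarrow> v \<in> carrier_vec n"
  by (auto simp: less_eq_vec_def)

lemma nonpos_mult_mat_vec:
  assumes M: "M \<in> carrier_mat m n" and "nonpos_mat M" and v: "0\<^sub>v n \<le> v"
  shows "M *\<^sub>v v \<le> 0\<^sub>v m"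
  using assms nonneg_vec_carrier[OF v]
  by (auto simp: less_eq_vec_def index_mult_mat_vec_sum[OF M] nonpos_mat_def
      simp del: index_mult_mat_vec intro!: sum_nonpos mult_nonpos_nonneg)

lemma nonneg_uminus_mult_mat:
  assumes "M \<in> carrier_mat l m" "N \<in> carrier_mat m n" "nonneg_mat M" "nonpos_mat N"
  shows "nonneg_mat (- (M * N))"
  using assms by (auto simp: nonneg_mat_def nonpos_mat_def scalar_prod_def intro!: sum_nonpos mult_nonneg_nonpos)

lemma nonneg_minus_mat:
  assumes "M \<in> carrier_mat m n" "N \<in> carrier_mat m n" "nonneg_mat M" "nonneg_mat (- N)"
  shows "nonneg_mat (M - N)"
proof -
  have "N $$ (i, j) \<le> M $$ (i, j)" if "i < m" "j < n" for i j
  proof -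
    have "0 \<le> M $$ (i, j)" "N $$ (i, j) \<le> 0"
      using assms that by (auto simp: nonneg_mat_def)
    then show ?thesis by simp
  qed
  then show ?thesis using assms by (simp add: nonneg_mat_def)
qed

lemma mult_mat_zero_vec: "M \<in> carrier_mat m n \<Longrightarrow> M *\<^sub>v 0\<^sub>v n = (0\<^sub>v m :: 'a :: comm_semiring_0 vec)"
  by (intro eq_vecI) auto

section \<open>Double proper splittings: projections, fixed-point form and convergence\<close>

locale double_proper =
  fixes A P R S :: "real mat" and m n :: nat
  assumes A: "A \<in> carrier_mat m n" and split: "double_proper_splitting A P R S"
begin

abbreviation "X \<equiv> mp_inverse P"
abbreviation "D \<equiv> mp_inverse A"

lemma carriers [simp]:
  "P \<in> carrier_mat m n" "R \<in> carrier_mat m n" "S \<in> carrier_mat m n" "A \<in> carrier_mat m n"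
  "X \<in> carrier_mat n m" "D \<in> carrier_mat n m"
proof -
  show "P \<in> carrier_mat m n" "R \<in> carrier_mat m n" "S \<in> carrier_mat m n" "A \<in> carrier_mat m n"
    using A split by (auto simp: double_proper_splitting_def)
  then show "X \<in> carrier_mat n m" "D \<in> carrier_mat n m" by (auto intro: mp_inverse)
qed

lemmas dims [simp] = carriers[THEN carrier_matD(1)] carriers[THEN carrier_matD(2)]
text \<open>The instances are numbered as in \<open>carriers\<close>, in the order \<open>P\<close>,
  \<open>R\<close>, \<open>S\<close>, \<open>A\<close>, \<open>X\<close>, \<open>D\<close>; so
  \<open>assoc_vec(5)\<close> is about the pseudoinverse of \<open>P\<close> and
  \<open>assoc_vec(6)\<close> about that of \<open>A\<close>.\<close>

lemmas vec_carriers [simp] = carriers[THEN mult_mat_vec_carrier]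
lemmas assoc_vec = carriers[THEN assoc_mult_mat_vec]
lemmas smult_vec = carriers[THEN mult_mat_vec]
lemmas add_vec = carriers[THEN mult_add_distrib_mat_vec]
lemmas minus_vec = carriers[THEN mult_minus_distrib_mat_vec]

lemma split_vec:
  assumes v: "v \<in> carrier_vec n"
  shows "A *\<^sub>v v = P *\<^sub>v v - R *\<^sub>v v + S *\<^sub>v v"
proof -
  have "A = P - R + S" using split by (simp add: double_proper_splitting_def)
  then have "A *\<^sub>v v = (P - R) *\<^sub>v v + S *\<^sub>v v"
    using v add_mult_distrib_mat_vec[of "P - R" m n S v] minus_carrier_mat[of R m n P] by simp
  then show ?thesis using v minus_mult_distrib_mat_vec[of P m n R v] by simp
qed

lemma proj_eq: "D * A = X * P" "A * D = P * X"
  using mp_inverse_null_eq[of A m n P m] mp_inverse_range_eq[of A m n P n] split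
  by (simp_all add: double_proper_splitting_def)

lemma D_A_vec: "v \<in> carrier_vec n \<Longrightarrow> D *\<^sub>v (A *\<^sub>v v) = X *\<^sub>v (P *\<^sub>v v)"
  and A_D_vec: "w \<in> carrier_vec m \<Longrightarrow> A *\<^sub>v (D *\<^sub>v w) = P *\<^sub>v (X *\<^sub>v w)"
  using proj_eq by (simp_all flip: assoc_vec(1)[of _ m] assoc_vec(4)[of _ m] assoc_vec(5)[of _ n] assoc_vec(6)[of _ n])

lemma P_X_absorb:
  assumes B: "B \<in> carrier_mat m k" and "range_mat B \<subseteq> range_mat P" and v: "v \<in> carrier_vec k"
  shows "P *\<^sub>v (X *\<^sub>v (B *\<^sub>v v)) = B *\<^sub>v v"
proof -
  have "P *\<^sub>v (X *\<^sub>v (B *\<^sub>v v)) = (P * X) *\<^sub>v (B *\<^sub>v v)"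
    using B v by (intro assoc_mult_mat_vec[symmetric, of _ m n _ m]) auto
  also have "\<dots> = (P * X * B) *\<^sub>v v"
    using B v by (intro assoc_mult_mat_vec[symmetric, of _ m m _ k]) auto
  finally have "P *\<^sub>v (X *\<^sub>v (B *\<^sub>v v)) = (P * X * B) *\<^sub>v v" .
  then show ?thesis using mp_inverse_range_absorb[of P m n B k] B assms by simp
qed

text \<open>\<open>S\<close> equals A - P + R, and all three terms map into the range of
  \<open>P\<close>.\<close>

lemma range_S:
  assumes rangeR: "range_mat R \<subseteq> range_mat P"
  shows "range_mat S \<subseteq> range_mat P"
proof
  fix w assume "w \<in> range_mat S"
  then obtain v where v: "v \<in> carrier_vec n" "w = S *\<^sub>v v"
    using carriers(3) by (auto simp: range_mat_def)
  have "R *\<^sub>v v \<in> range_mat R" "A *\<^sub>v v \<in> range_mat A"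
    using v(1) by (auto simp: range_mat_def)
  then have "R *\<^sub>v v \<in> range_mat P" "A *\<^sub>v v \<in> range_mat P"
    using rangeR split by (auto simp: double_proper_splitting_def)
  then obtain a b where ab: "a \<in> carrier_vec n" "b \<in> carrier_vec n" "R *\<^sub>v v = P *\<^sub>v a" "A *\<^sub>v v = P *\<^sub>v b"
    using carriers(1) by (auto simp: range_mat_def)
  have "w = P *\<^sub>v b - P *\<^sub>v v + P *\<^sub>v a"
  proof (rule eq_vecI)
    fix i assume "i < dim_vec (P *\<^sub>v b - P *\<^sub>v v + P *\<^sub>v a)"
    then have i: "i < m" using carriers(1) by simp
    have "(A *\<^sub>v v) $ i = (P *\<^sub>v v - R *\<^sub>v v + S *\<^sub>v v) $ i" using split_vec[OF v(1)] by simp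
    then show "w $ i = (P *\<^sub>v b - P *\<^sub>v v + P *\<^sub>v a) $ i"
      unfolding ab v(2) using i carriers by (simp del: index_mult_mat_vec)
  qed (use v carriers in simp)
  also have "\<dots> = P *\<^sub>v (b - v + a)"
    using ab v by (simp add: add_vec minus_vec)
  finally show "w \<in> range_mat P" using ab v carriers(1) by (auto simp: range_mat_def)
qed

text \<open>For u = D w one has X P u = D A D w = u and X A u = X P X w = X w, so applying
  \<open>X\<close> to the splitting of A u gives the equation. It says that the companion matrix
  sends (u, u) to (u - X w, u), which links A^+ to the iteration.\<close>

lemma solution_of_A:
  assumes w: "w \<in> carrier_vec m"
  shows "D *\<^sub>v w = X *\<^sub>v w + X *\<^sub>v (R *\<^sub>v (D *\<^sub>v w)) - X *\<^sub>v (S *\<^sub>v (D *\<^sub>v w))"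
proof -
  define u where "u = D *\<^sub>v w"
  have u: "u \<in> carrier_vec n" using w by (simp add: u_def)
  have "X *\<^sub>v (P *\<^sub>v u) = (D * A * D) *\<^sub>v w"
    using w D_A_vec[OF u] assoc_mult_mat_vec[of "D * A" n n D m w] by (simp add: u_def assoc_vec(6)[of _ n])
  then have Xu: "X *\<^sub>v (P *\<^sub>v u) = u" using mp_inverse(3)[OF A] by (simp add: u_def)
  have "X *\<^sub>v (A *\<^sub>v u) = (X * P * X) *\<^sub>v w"
    using w A_D_vec[OF w] assoc_mult_mat_vec[of "X * P" n n X m w] by (simp add: u_def assoc_vec(5)[of _ n])
  then have "X *\<^sub>v (A *\<^sub>v u) = X *\<^sub>v w" using mp_inverse(3)[of P m n] by simp
  moreover have "X *\<^sub>v (A *\<^sub>v u) = u - X *\<^sub>v (R *\<^sub>v u) + X *\<^sub>v (S *\<^sub>v u)"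
    using u Xu by (simp add: split_vec add_vec minus_vec)
  ultimately have eq: "X *\<^sub>v w = u - X *\<^sub>v (R *\<^sub>v u) + X *\<^sub>v (S *\<^sub>v u)" by simp
  have "u = X *\<^sub>v w + X *\<^sub>v (R *\<^sub>v u) - X *\<^sub>v (S *\<^sub>v u)"
    unfolding eq using u carriers by (intro eq_vecI) (auto simp del: index_mult_mat_vec)
  then show ?thesis by (simp add: u_def)
qed

text \<open>The eigenvalue equation of a companion matrix gives \<open>q\<close> only under P^+. As
  \<open>q\<close> lies in the range of \<open>P\<close>, applying \<open>P\<close> recovers it;
  substituting the result back yields X P y = y, so \<open>y\<close> can be reconstructed from A
  y.\<close>

lemma lift_eigenvector:
  assumes q: "q \<in> carrier_vec m" "P *\<^sub>v (X *\<^sub>v q) = q" and y: "y \<in> carrier_vec n"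
    and c: "c \<noteq> 0" "X *\<^sub>v q = c \<cdot>\<^sub>v y"
  shows "q = c \<cdot>\<^sub>v (P *\<^sub>v y)" "D *\<^sub>v (A *\<^sub>v y) = y"
proof -
  show 1: "q = c \<cdot>\<^sub>v (P *\<^sub>v y)" using q(2) y by (simp add: c(2) smult_vec)
  have "c \<cdot>\<^sub>v (X *\<^sub>v (P *\<^sub>v y)) = c \<cdot>\<^sub>v y"
    using c(2) y unfolding 1 by (simp add: smult_vec)
  then have "(1/c) \<cdot>\<^sub>v (c \<cdot>\<^sub>v (X *\<^sub>v (P *\<^sub>v y))) = (1/c) \<cdot>\<^sub>v (c \<cdot>\<^sub>v y)" by simp
  then have "X *\<^sub>v (P *\<^sub>v y) = y" using c(1) by (simp add: smult_smult_assoc)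
  then show "D *\<^sub>v (A *\<^sub>v y) = y" using D_A_vec[OF y] by simp
qed

text \<open>With l r - s = l^2 p, the vector A y = p - r + s satisfies l A y = (1 - l)(l p - s).
  Applying A^+ gives l y on the left and, if l >= 1, a nonpositive vector on the right, although
  \<open>y\<close> has a positive entry.\<close>

lemma companion_rho_less_1:
  assumes n: "0 < n" and rangeR: "range_mat R \<subseteq> range_mat P"
    and nn: "nonneg_mat X" "nonneg_mat R" "nonpos_mat S" "nonneg_mat D"
  shows "rho (companion_mat (X * R) (- (X * S)) n) < 1"
proof (rule ccontr)
  define l where "l = rho (companion_mat (X * R) (- (X * S)) n)"
  assume "\<not> ?thesis"
  then have l: "1 \<le> l" by (simp add: l_def)
  have U: "X * R \<in> carrier_mat n n" "nonneg_mat (X * R)"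
    using nonneg_mult_mat[OF carriers(5,2)] nn carriers by auto
  have V: "- (X * S) \<in> carrier_mat n n" "nonneg_mat (- (X * S))"
    using nonneg_uminus_mult_mat[OF carriers(5,3)] nn carriers by auto
  obtain y where y: "0\<^sub>v n \<le> y" "y \<noteq> 0\<^sub>v n"
      "l \<cdot>\<^sub>v (X * R *\<^sub>v y) + - (X * S) *\<^sub>v y = l\<^sup>2 \<cdot>\<^sub>v y"
    using companion_mat_perron_vector[OF U V n l_def] l by auto
  have yc [simp]: "y \<in> carrier_vec n" using y(1) by (rule nonneg_vec_carrier)
  define r s p where "r = R *\<^sub>v y" and "s = S *\<^sub>v y" and "p = P *\<^sub>v y"
  have c [simp]: "r \<in> carrier_vec m" "s \<in> carrier_vec m" "p \<in> carrier_vec m"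
    by (simp_all add: r_def s_def p_def)
  note [simp] = c[THEN carrier_vecD]
  define q where "q = l \<cdot>\<^sub>v r - s"
  have qc [simp]: "q \<in> carrier_vec m" by (simp add: q_def)
  have Pq: "P *\<^sub>v (X *\<^sub>v q) = q"
    using P_X_absorb[OF carriers(2) rangeR yc] P_X_absorb[OF carriers(3) range_S[OF rangeR] yc]
    by (simp add: q_def r_def s_def minus_vec smult_vec)
  have "l \<cdot>\<^sub>v (X *\<^sub>v r) + - (X *\<^sub>v s) = l\<^sup>2 \<cdot>\<^sub>v y"
    using y(3) by (simp add: r_def s_def assoc_vec(5)[of _ n])
  moreover have "X *\<^sub>v q = l \<cdot>\<^sub>v (X *\<^sub>v r) + - (X *\<^sub>v s)"
    unfolding q_def by (simp add: minus_vec smult_vec minus_add_uminus_vec[of _ n])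
  ultimately have Xq: "X *\<^sub>v q = l\<^sup>2 \<cdot>\<^sub>v y" by simp
  have lift: "q = l\<^sup>2 \<cdot>\<^sub>v p" "D *\<^sub>v (A *\<^sub>v y) = y"
    unfolding p_def using lift_eigenvector[OF qc Pq yc _ Xq] l by simp_all
  have r0: "0 \<le> r $ i" and s0: "s $ i \<le> 0" if "i < m" for i
    using that nonneg_mult_mat_vec[OF carriers(2) nn(2) y(1)]
      nonpos_mult_mat_vec[OF carriers(3) nn(3) y(1)] c
    by (simp_all add: r_def[symmetric] s_def[symmetric] less_eq_vec_def)
  have q_eq: "l * r $ i - s $ i = l\<^sup>2 * p $ i" if "i < m" for i
    using that arg_cong[OF lift(1), of "\<lambda>v. v $ i"] c by (simp add: q_def)
  have p0: "0 \<le> p $ i" if "i < m" for i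
  proof -
    have "0 \<le> l\<^sup>2 * p $ i" unfolding q_eq[OF that, symmetric] 
      using mult_nonneg_nonneg[of l "r $ i"] r0[OF that] s0[OF that] l by linarith
    then show ?thesis using l by (simp add: zero_le_mult_iff)
  qed
  have "l \<cdot>\<^sub>v (A *\<^sub>v y) = (1 - l) \<cdot>\<^sub>v (l \<cdot>\<^sub>v p - s)"
  proof (rule eq_vecI)
    fix i assume "i < dim_vec ((1 - l) \<cdot>\<^sub>v (l \<cdot>\<^sub>v p - s))"
    then have i: "i < m" using c by simp
    have "(A *\<^sub>v y) $ i = p $ i - r $ i + s $ i"
      using i c split_vec[OF yc] by (simp add: p_def[symmetric] r_def[symmetric] s_def[symmetric])
    moreover have "l * (p $ i - r $ i + s $ i) = (1 - l) * (l * p $ i - s $ i)"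
      using q_eq[OF i] by (simp add: algebra_simps power2_eq_square)
    ultimately show "(l \<cdot>\<^sub>v (A *\<^sub>v y)) $ i = ((1 - l) \<cdot>\<^sub>v (l \<cdot>\<^sub>v p - s)) $ i"
      using i by (simp del: index_mult_mat_vec)
  qed (use c in simp)
  then have "D *\<^sub>v (l \<cdot>\<^sub>v (A *\<^sub>v y)) = D *\<^sub>v ((1 - l) \<cdot>\<^sub>v (l \<cdot>\<^sub>v p - s))" by simp
  then have eq: "l \<cdot>\<^sub>v y = (1 - l) \<cdot>\<^sub>v (D *\<^sub>v (l \<cdot>\<^sub>v p - s))"
    by (simp add: smult_vec lift)
  have "0\<^sub>v m \<le> l \<cdot>\<^sub>v p - s"
    using p0 s0 l c by (auto simp: less_eq_vec_def intro: order_trans[of _ 0])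
  then have h: "0\<^sub>v n \<le> D *\<^sub>v (l \<cdot>\<^sub>v p - s)" using nonneg_mult_mat_vec[OF carriers(6) nn(4)] by simp
  obtain i where i: "i < n" "0 < y $ i" using nonneg_nonzero_vec_pos[OF y(1,2)] .
  have "l * y $ i = (1 - l) * (D *\<^sub>v (l \<cdot>\<^sub>v p - s)) $ i"
    using arg_cong[OF eq, of "\<lambda>v. v $ i"] i yc by (simp del: index_mult_mat_vec)
  moreover have "0 \<le> (D *\<^sub>v (l \<cdot>\<^sub>v p - s)) $ i" using h i by (simp add: less_eq_vec_def)
  moreover have "0 < l * y $ i" using i l by simp
  ultimately show False using l by (simp add: zero_less_mult_iff)
qed

end

section \<open>Comparison of the iteration matrices W and T2\<close>

theorem theorem3p15:
  fixes A P1 R1 S1 P2 R2 S2 :: "real mat" and m n :: nat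
  assumes A: "A \<in> carrier_mat m n" and mn: "0 < m" "0 < n"
    and semi: "semi_monotone A"
    and spl1: "double_proper_weak_regular A P1 R1 S1"
    and spl2: "double_proper_regular A P2 R2 S2"
    and nullR2: "null_mat P2 \<subseteq> null_mat R2"
    and rangeR2: "range_mat R2 \<subseteq> range_mat P2"
    and spec: "- 1 \<notin> spectrum (cmat (R2 * mp_inverse P1))"
    and Ahat: "nonneg_mat (mp_inverse ((1\<^sub>m m + R2 * mp_inverse P1) * A))"
    and cond: "nonpos_mat (mp_inverse P2 * R2 + mp_inverse P2 * S2)"
  shows "rho (four_block_mat
              (mp_inverse P2 * R2 * mp_inverse P1 * R1 - mp_inverse P2 * S2)
              (- (mp_inverse P2 * R2 * mp_inverse P1 * S1))
              (1\<^sub>m n) (0\<^sub>m n n))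
         \<le> rho (four_block_mat (mp_inverse P2 * R2) (- (mp_inverse P2 * S2))
              (1\<^sub>m n) (0\<^sub>m n n))
       \<and> rho (four_block_mat (mp_inverse P2 * R2) (- (mp_inverse P2 * S2))
              (1\<^sub>m n) (0\<^sub>m n n)) < 1"
proof -
  let ?X1 = "mp_inverse P1" and ?X2 = "mp_inverse P2" and ?D = "mp_inverse A"
  define T where "T = companion_mat (?X2 * R2) (- (?X2 * S2)) n"
  define W where "W = companion_mat (?X2 * R2 * ?X1 * R1 - ?X2 * S2) (- (?X2 * R2 * ?X1 * S1)) n"
  have split: "double_proper_splitting A P1 R1 S1" "double_proper_splitting A P2 R2 S2"
    using spl1 spl2 by (simp_all add: double_proper_weak_regular_def double_proper_regular_def)
  interpret s1: double_proper A P1 R1 S1 m n by unfold_locales (use A split in simp_all)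
  interpret s2: double_proper A P2 R2 S2 m n by unfold_locales (use A split in simp_all)
  note [simp] = s1.carriers s2.carriers s1.vec_carriers s2.vec_carriers s1.dims s2.dims
  have D0: "nonneg_mat ?D" using semi by (simp add: semi_monotone_def)
  have nn1: "nonneg_mat ?X1" "nonneg_mat (?X1 * R1)" "nonpos_mat (?X1 * S1)"
    using spl1 by (simp_all add: double_proper_weak_regular_def)
  have nn2: "nonneg_mat ?X2" "nonneg_mat R2" "nonpos_mat S2"
    using spl2 by (simp_all add: double_proper_regular_def)
  have T1: "rho T < 1"
    unfolding T_def using s2.companion_rho_less_1[OF mn(2) rangeR2 nn2 D0] .
  have XR: "?X2 * R2 \<in> carrier_mat n n" "nonneg_mat (?X2 * R2)"
    using nonneg_mult_mat[OF s2.carriers(5,2)] nn2 mult_carrier_mat[OF s2.carriers(5,2)] by auto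
  have XS: "- (?X2 * S2) \<in> carrier_mat n n" "nonneg_mat (- (?X2 * S2))"
    using nonneg_uminus_mult_mat[OF s2.carriers(5,3)] nn2 mult_carrier_mat[OF s2.carriers(5,3)] by auto
  have T: "T \<in> carrier_mat (n + n) (n + n)" "nonneg_mat T"
    unfolding T_def using XR XS nonneg_companion_mat by simp_all

  have T_vec: "T *\<^sub>v (u @\<^sub>v v) = (?X2 *\<^sub>v (R2 *\<^sub>v u) - ?X2 *\<^sub>v (S2 *\<^sub>v v)) @\<^sub>v u"
    if u: "u \<in> carrier_vec n" and v: "v \<in> carrier_vec n" for u v
  proof -
    have "- (?X2 * S2) *\<^sub>v v = - (?X2 *\<^sub>v (S2 *\<^sub>v v))"
      using v s2.assoc_vec(5)[OF s2.carriers(3) v] by (subst uminus_mult_mat_vec) auto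
    moreover have "?X2 * R2 *\<^sub>v u = ?X2 *\<^sub>v (R2 *\<^sub>v u)" by (rule s2.assoc_vec(5)[OF s2.carriers(2) u])
    ultimately show ?thesis
      unfolding T_def companion_mat_mult_vec[OF XR(1) XS(1) u v]
      using u v by (simp add: minus_add_uminus_vec[of _ n])
  qed

  define K where "K = R2 * ?X1"
  have K: "K \<in> carrier_mat m m" "nonneg_mat K"
    unfolding K_def using nonneg_mult_mat[OF s2.carriers(2) s1.carriers(5)] nn1 nn2
      mult_carrier_mat[OF s2.carriers(2) s1.carriers(5)] by auto
  have K_vec: "K *\<^sub>v v = R2 *\<^sub>v (?X1 *\<^sub>v v)" if "v \<in> carrier_vec m" for v
    unfolding K_def using that by (intro s2.assoc_vec(2)) auto
  have Kc [simp]: "K *\<^sub>v v \<in> carrier_vec m" if "v \<in> carrier_vec m" for v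
    using K(1) that by (rule mult_mat_vec_carrier)
  define H where "H = (1\<^sub>m m + K) * A"
  let ?DH = "mp_inverse H"
  have H: "H \<in> carrier_mat m n" unfolding H_def using K(1) by (intro mult_carrier_mat[of _ m m]) auto
  have DH: "?DH \<in> carrier_mat n m" using mp_inverse(1)[OF H] .
  have DH0: "nonneg_mat ?DH" using Ahat by (simp add: H_def K_def)
  have H_vec: "H *\<^sub>v v = A *\<^sub>v v + K *\<^sub>v (A *\<^sub>v v)" if v: "v \<in> carrier_vec n" for v
  proof -
    have "H *\<^sub>v v = (1\<^sub>m m + K) *\<^sub>v (A *\<^sub>v v)"
      unfolding H_def using K(1) v by (intro assoc_mult_mat_vec[of _ m m]) auto
    then show ?thesis using K(1) v by (simp add: add_mult_distrib_mat_vec[of _ m m])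
  qed
  \<comment> \<open>The spectral hypothesis makes \<open>1\<^sub>m m + K\<close> injective: a real
    vector negated by \<open>K\<close> would give the complex eigenvalue -1. Equal null spaces then
    yield H^+ H = A^+ A.\<close>
  have null_H: "null_mat H = null_mat A"
  proof -
    have "A *\<^sub>v v = 0\<^sub>v m" if v: "v \<in> carrier_vec n" "H *\<^sub>v v = 0\<^sub>v m" for v
    proof (rule ccontr)
      define w where "w = A *\<^sub>v v"
      assume "A *\<^sub>v v \<noteq> 0\<^sub>v m"
      then have w: "w \<in> carrier_vec m" "w \<noteq> 0\<^sub>v m" using v by (simp_all add: w_def)
      have "K *\<^sub>v w = - 1 \<cdot>\<^sub>v w"
      proof (rule eq_vecI)
        fix i assume "i < dim_vec (- 1 \<cdot>\<^sub>v w)"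
        then have i: "i < m" using w by simp
        have "(w + K *\<^sub>v w) $ i = 0\<^sub>v m $ i" using v H_vec by (simp add: w_def)
        then show "(K *\<^sub>v w) $ i = (- 1 \<cdot>\<^sub>v w) $ i" using i w K(1) by (simp del: index_mult_mat_vec)
      qed (use w K in simp)
      then have "eigenvalue K (- 1)"
        using w K(1) unfolding eigenvalue_def eigenvector_def by auto
      from of_real_hom.eigenvalue_hom[OF K(1) this, where 'a = complex]
      show False using spec by (simp add: spectrum_def cmat_def K_def)
    qed
    moreover have "H *\<^sub>v v = 0\<^sub>v m" if v: "v \<in> carrier_vec n" "A *\<^sub>v v = 0\<^sub>v m" for v
      using H_vec[OF v(1)] K(1) unfolding v(2) by (simp add: mult_mat_zero_vec[OF K(1)])
    ultimately show ?thesis using H A by (auto simp: null_mat_def)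
  qed
  have DH_H: "?DH *\<^sub>v (H *\<^sub>v v) = ?D *\<^sub>v (A *\<^sub>v v)" if v: "v \<in> carrier_vec n" for v
  proof -
    have "?DH *\<^sub>v (H *\<^sub>v v) = (?DH * H) *\<^sub>v v"
      using assoc_mult_mat_vec[OF DH H v] by simp
    also have "\<dots> = (?D * A) *\<^sub>v v" using mp_inverse_null_eq[OF H A null_H] by simp
    also have "\<dots> = ?D *\<^sub>v (A *\<^sub>v v)" using v by (intro s1.assoc_vec(6)) auto
    finally show ?thesis .
  qed
  \<comment> \<open>The null spaces of \<open>P1\<close>, \<open>A\<close> and \<open>P2\<close>
    coincide, so \<open>R2\<close> absorbs the projection P1^+ P1. This is what reduces the term R2
    P1^+ P1 y in the expansion of K A y to R2 y.\<close>
  have "null_mat P1 \<subseteq> null_mat R2"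
    using nullR2 split by (auto simp: double_proper_splitting_def)
  then have "R2 * (?X1 * P1) = R2" by (intro mp_inverse_null_absorb) auto
  then have R2_proj: "R2 *\<^sub>v (?X1 *\<^sub>v (P1 *\<^sub>v v)) = R2 *\<^sub>v v" if "v \<in> carrier_vec n" for v
    using that assoc_mult_mat_vec[of R2 m n "?X1 * P1" n v] s1.assoc_vec(5)[of P1 n v]
      mult_carrier_mat[OF s1.carriers(5,1)] by simp

  have "rho W \<le> rho T"
  proof (cases "0 < rho W")
    case False
    then show ?thesis using rho_nonneg[OF T(1)] mn by simp
  next
    case True
    define l where "l = rho W"
    have l: "0 < l" using True by (simp add: l_def)
    have X1R1: "?X1 * R1 \<in> carrier_mat n n" and X1S1: "?X1 * S1 \<in> carrier_mat n n"
      and X2S2: "?X2 * S2 \<in> carrier_mat n n"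
      using mult_carrier_mat[OF s1.carriers(5,2)] mult_carrier_mat[OF s1.carriers(5,3)]
        mult_carrier_mat[OF s2.carriers(5,3)] .
    have assocR: "?X2 * R2 * ?X1 * R1 = ?X2 * R2 * (?X1 * R1)"
      and assocS: "?X2 * R2 * ?X1 * S1 = ?X2 * R2 * (?X1 * S1)"
      using assoc_mult_mat[OF XR(1) s1.carriers(5,2)] assoc_mult_mat[OF XR(1) s1.carriers(5,3)] .
    have XRXR: "?X2 * R2 * (?X1 * R1) \<in> carrier_mat n n" and XRXS: "?X2 * R2 * (?X1 * S1) \<in> carrier_mat n n"
      using mult_carrier_mat[OF XR(1)] X1R1 X1S1 by simp_all
    have WU: "?X2 * R2 * ?X1 * R1 - ?X2 * S2 \<in> carrier_mat n n"
        "nonneg_mat (?X2 * R2 * ?X1 * R1 - ?X2 * S2)"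
      unfolding assocR
      using minus_carrier_mat[OF X2S2]
        nonneg_minus_mat[OF XRXR X2S2 nonneg_mult_mat[OF XR(1) X1R1 XR(2) nn1(2)] XS(2)] by blast+
    have WV: "- (?X2 * R2 * ?X1 * S1) \<in> carrier_mat n n" "nonneg_mat (- (?X2 * R2 * ?X1 * S1))"
      unfolding assocS
      using XRXS nonneg_uminus_mult_mat[OF XR(1) X1S1 XR(2) nn1(3)] by (blast intro: uminus_carrier_mat)+
    obtain y where y: "0\<^sub>v n \<le> y" "y \<noteq> 0\<^sub>v n"
        "l \<cdot>\<^sub>v ((?X2 * R2 * ?X1 * R1 - ?X2 * S2) *\<^sub>v y) + - (?X2 * R2 * ?X1 * S1) *\<^sub>v y = l\<^sup>2 \<cdot>\<^sub>v y"
      using companion_mat_perron_vector[OF WU WV mn(2) l_def[unfolded W_def] l] .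
    have yc [simp]: "y \<in> carrier_vec n" using y(1) by (rule nonneg_vec_carrier)
    note [simp] = carrier_vecD[OF yc]
    define p r s where "p = P2 *\<^sub>v y" and "r = R2 *\<^sub>v y" and "s = S2 *\<^sub>v y"
    define a b where "a = R2 *\<^sub>v (?X1 *\<^sub>v (R1 *\<^sub>v y))" and "b = R2 *\<^sub>v (?X1 *\<^sub>v (S1 *\<^sub>v y))"
    define z where "z = K *\<^sub>v (A *\<^sub>v y)"
    have c [simp]: "p \<in> carrier_vec m" "r \<in> carrier_vec m" "s \<in> carrier_vec m"
        "a \<in> carrier_vec m" "b \<in> carrier_vec m" "z \<in> carrier_vec m"
      by (simp_all add: p_def r_def s_def a_def b_def z_def)
    note [simp] = c[THEN carrier_vecD]
    note sym = p_def[symmetric] r_def[symmetric] s_def[symmetric] a_def[symmetric] b_def[symmetric] z_def[symmetric]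
    have r0: "0 \<le> r $ i" and s0: "s $ i \<le> 0" if "i < m" for i
      using that nonneg_mult_mat_vec[OF s2.carriers(2) nn2(2) y(1)]
        nonpos_mult_mat_vec[OF s2.carriers(3) nn2(3) y(1)] c
      by (simp_all add: sym less_eq_vec_def)
    have a_nonneg: "0\<^sub>v m \<le> a"
    proof -
      have "0\<^sub>v n \<le> (?X1 * R1) *\<^sub>v y" by (rule nonneg_mult_mat_vec[OF X1R1 nn1(2) y(1)])
      then show ?thesis unfolding a_def s1.assoc_vec(5)[OF s1.carriers(2) yc]
        by (rule nonneg_mult_mat_vec[OF s2.carriers(2) nn2(2)])
    qed
    have b_nonpos: "b \<le> 0\<^sub>v m"
    proof -
      have "(?X1 * S1) *\<^sub>v y \<le> 0\<^sub>v n" by (rule nonpos_mult_mat_vec[OF X1S1 nn1(3) y(1)])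
      then have "R2 *\<^sub>v (?X1 *\<^sub>v (S1 *\<^sub>v y)) \<le> R2 *\<^sub>v 0\<^sub>v n"
        unfolding s1.assoc_vec(5)[OF s1.carriers(3) yc]
        by (rule mult_mat_vec_mono[OF s2.carriers(2) nn2(2) zero_carrier_vec])
      then show ?thesis by (simp add: b_def mult_mat_zero_vec[OF s2.carriers(2)])
    qed
    have a0: "0 \<le> a $ i" and b0: "b $ i \<le> 0" if "i < m" for i
      using that a_nonneg b_nonpos by (simp_all add: less_eq_vec_def)

    \<comment> \<open>The eigenvalue equation reads P2^+ q = l^2 y. Every term of \<open>q\<close>
      lies in the range of \<open>P2\<close>, so \<open>lift_eigenvector\<close> can remove
      P2^+.\<close>
    define q where "q = l \<cdot>\<^sub>v a - l \<cdot>\<^sub>v s - b"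
    have qc [simp]: "q \<in> carrier_vec m" by (simp add: q_def)
    have Pq: "P2 *\<^sub>v (?X2 *\<^sub>v q) = q"
      using s2.P_X_absorb[OF s2.carriers(2) rangeR2]
        s2.P_X_absorb[OF s2.carriers(3) s2.range_S[OF rangeR2] yc]
      by (simp add: q_def a_def b_def s_def s2.minus_vec s2.smult_vec)
    have Xq: "?X2 *\<^sub>v q = l\<^sup>2 \<cdot>\<^sub>v y"
    proof -
      have "(?X2 * R2 * (?X1 * R1)) *\<^sub>v y = ?X2 *\<^sub>v a"
        unfolding assoc_mult_mat_vec[OF XR(1) X1R1 yc] s1.assoc_vec(5)[OF s1.carriers(2) yc] a_def
        by (intro s2.assoc_vec(5)[OF s2.carriers(2)]) simp
      then have U: "(?X2 * R2 * ?X1 * R1 - ?X2 * S2) *\<^sub>v y = ?X2 *\<^sub>v a - ?X2 *\<^sub>v s"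
        unfolding assocR minus_mult_distrib_mat_vec[OF XRXR X2S2 yc]
        using s2.assoc_vec(5)[OF s2.carriers(3) yc] by (simp add: s_def)
      have "(?X2 * R2 * (?X1 * S1)) *\<^sub>v y = ?X2 *\<^sub>v b"
        unfolding assoc_mult_mat_vec[OF XR(1) X1S1 yc] s1.assoc_vec(5)[OF s1.carriers(3) yc] b_def
        by (intro s2.assoc_vec(5)[OF s2.carriers(2)]) simp
      then have V: "- (?X2 * R2 * ?X1 * S1) *\<^sub>v y = - (?X2 *\<^sub>v b)"
        unfolding assocS using XRXS yc by (subst uminus_mult_mat_vec) auto
      have "?X2 *\<^sub>v q = l \<cdot>\<^sub>v (?X2 *\<^sub>v a - ?X2 *\<^sub>v s) + - (?X2 *\<^sub>v b)"
        by (rule eq_vecI)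
          (simp_all add: q_def s2.minus_vec s2.smult_vec algebra_simps del: index_mult_mat_vec)
      then show ?thesis using y(3) by (simp only: U V)
    qed
    have lift: "q = l\<^sup>2 \<cdot>\<^sub>v p" "?D *\<^sub>v (A *\<^sub>v y) = y"
      unfolding p_def using s2.lift_eigenvector[OF qc Pq yc _ Xq] l by simp_all
    have q_eq: "l * a $ i - l * s $ i - b $ i = l\<^sup>2 * p $ i" if "i < m" for i
      using that arg_cong[OF lift(1), of "\<lambda>v. v $ i"] c by (simp add: q_def)
    have p0: "0 \<le> p $ i" if "i < m" for i
    proof -
      have "l * s $ i \<le> 0" "0 \<le> l * a $ i" using l s0[OF that] a0[OF that] by (simp_all add: mult_le_0_iff)
      then have "0 \<le> l\<^sup>2 * p $ i" unfolding q_eq[OF that, symmetric] using b0[OF that] by linarith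
      then show ?thesis using l by (simp add: zero_le_mult_iff)
    qed
    have Ay: "(A *\<^sub>v y) $ i = p $ i - r $ i + s $ i" if "i < m" for i
      using that c s2.split_vec[OF yc] by (simp add: sym)
    have z_eq: "z = r - a + b"
      unfolding z_def using K_vec[of "A *\<^sub>v y"] s1.split_vec[OF yc] R2_proj[OF yc]
      by (simp add: s1.add_vec s1.minus_vec s2.add_vec s2.minus_vec sym)
    \<comment> \<open>The vector \<open>r\<close> cancels between A y and K A y, leaving p + s - a +
      b; then \<open>q_eq\<close> eliminates \<open>a\<close> and \<open>s\<close>.\<close>
    have Hy: "l \<cdot>\<^sub>v (H *\<^sub>v y) = (1 - l) \<cdot>\<^sub>v (l \<cdot>\<^sub>v p - b)"
    proof (rule eq_vecI)
      fix i assume "i < dim_vec ((1 - l) \<cdot>\<^sub>v (l \<cdot>\<^sub>v p - b))"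
      then have i: "i < m" using c by simp
      have "(H *\<^sub>v y) $ i = p $ i - r $ i + s $ i + (r $ i - a $ i + b $ i)"
        using i Ay[OF i] H_vec[OF yc] z_eq c by (simp add: sym del: index_mult_mat_vec)
      moreover have "l * (p $ i - r $ i + s $ i + (r $ i - a $ i + b $ i)) = (1 - l) * (l * p $ i - b $ i)"
        using q_eq[OF i] by (simp add: algebra_simps power2_eq_square)
      ultimately show "(l \<cdot>\<^sub>v (H *\<^sub>v y)) $ i = ((1 - l) \<cdot>\<^sub>v (l \<cdot>\<^sub>v p - b)) $ i"
        using i H by (simp del: index_mult_mat_vec)
    qed (use c H in simp)
    have lpb: "0\<^sub>v m \<le> l \<cdot>\<^sub>v p - b"
      using p0 b0 l c by (auto simp: less_eq_vec_def intro: order_trans[of _ 0])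
    have Hyc: "H *\<^sub>v y \<in> carrier_vec m" using H by simp
    have "?DH *\<^sub>v (l \<cdot>\<^sub>v (H *\<^sub>v y)) = ?DH *\<^sub>v ((1 - l) \<cdot>\<^sub>v (l \<cdot>\<^sub>v p - b))" by (simp add: Hy)
    then have eq: "l \<cdot>\<^sub>v y = (1 - l) \<cdot>\<^sub>v (?DH *\<^sub>v (l \<cdot>\<^sub>v p - b))"
      using DH_H[OF yc] Hyc by (simp add: mult_mat_vec[OF DH] lift)
    have l1: "l < 1"
    proof -
      obtain i where i: "i < n" "0 < y $ i" using nonneg_nonzero_vec_pos[OF y(1,2)] .
      have "l * y $ i = (1 - l) * (?DH *\<^sub>v (l \<cdot>\<^sub>v p - b)) $ i"
        using arg_cong[OF eq, of "\<lambda>v. v $ i"] i yc DH by (simp del: index_mult_mat_vec)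
      moreover have "0 \<le> (?DH *\<^sub>v (l \<cdot>\<^sub>v p - b)) $ i"
        using nonneg_mult_mat_vec[OF DH DH0 lpb] i carrier_matD(1)[OF DH] by (simp add: less_eq_vec_def del: index_mult_mat_vec)
      moreover have "0 < l * y $ i" using i l by simp
      ultimately show ?thesis by (simp add: zero_less_mult_iff)
    qed

    have A_D_z: "A *\<^sub>v (?D *\<^sub>v z) = z"
      unfolding z_def using K_vec[of "A *\<^sub>v y"] s2.A_D_vec s2.P_X_absorb[OF s2.carriers(2) rangeR2] by simp
    \<comment> \<open>\<open>K\<close> commutes with I + K, and z = K A y lies in the range of
      \<open>R2\<close>, hence in that of \<open>A\<close>. So K H y = (I + K) z = (I + K) A (A^+ z)
      = H (A^+ z), and H^+ H acts as A^+ A.\<close>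
    have "?DH *\<^sub>v (K *\<^sub>v (H *\<^sub>v y)) = ?D *\<^sub>v z"
    proof -
      have "K *\<^sub>v (H *\<^sub>v y) = z + K *\<^sub>v z"
        unfolding H_vec[OF yc] using K(1) by (simp add: mult_add_distrib_mat_vec[OF K(1)] sym)
      also have "\<dots> = H *\<^sub>v (?D *\<^sub>v z)" using H_vec[of "?D *\<^sub>v z"] A_D_z by simp
      finally have "?DH *\<^sub>v (K *\<^sub>v (H *\<^sub>v y)) = ?D *\<^sub>v (A *\<^sub>v (?D *\<^sub>v z))" using DH_H by simp
      then show ?thesis by (simp add: A_D_z)
    qed
    moreover have "0\<^sub>v m \<le> H *\<^sub>v y"
    proof -
      have "0 \<le> (H *\<^sub>v y) $ i" if i: "i < m" for i
      proof -
        have "l * (H *\<^sub>v y) $ i = (1 - l) * (l \<cdot>\<^sub>v p - b) $ i"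
          using arg_cong[OF Hy, of "\<lambda>v. v $ i"] i c H by (simp del: index_mult_mat_vec)
        also have "\<dots> \<ge> 0" using lpb l1 i by (intro mult_nonneg_nonneg) (auto simp: less_eq_vec_def)
        finally show ?thesis using l by (simp add: zero_le_mult_iff)
      qed
      then show ?thesis using H by (simp add: less_eq_vec_def)
    qed
    ultimately have Dz: "0\<^sub>v n \<le> ?D *\<^sub>v z"
      using nonneg_mult_mat_vec[OF DH DH0 nonneg_mult_mat_vec[OF K]] by metis
    have Da: "0\<^sub>v n \<le> ?D *\<^sub>v a" using nonneg_mult_mat_vec[OF s1.carriers(6) D0 a_nonneg] .

    \<comment> \<open>The hypothesis gives a sign to -(s + r) only under P2^+, while the sign is
      wanted under A^+. It is transferred through \<open>T\<close>: (I - T)(w, w) = (- P2^+ (s + r),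
      0) >= 0, and rho(T) < 1 makes (w, w) nonnegative.\<close>
    define w where "w = ?D *\<^sub>v (- 1 \<cdot>\<^sub>v (s + r))"
    have wc [simp]: "w \<in> carrier_vec n" by (simp add: w_def)
    note [simp] = carrier_vecD[OF wc]
    have w_nonneg: "0\<^sub>v n \<le> w"
    proof -
      have "(?X2 * R2 + ?X2 * S2) *\<^sub>v y = ?X2 *\<^sub>v r + ?X2 *\<^sub>v s"
        using s2.assoc_vec(5)[OF s2.carriers(2) yc] s2.assoc_vec(5)[OF s2.carriers(3) yc]
          add_mult_distrib_mat_vec[OF XR(1) X2S2 yc] by (simp add: r_def s_def)
      moreover have "(?X2 * R2 + ?X2 * S2) *\<^sub>v y \<le> 0\<^sub>v n"
        using X2S2 by (intro nonpos_mult_mat_vec[OF _ cond y(1)]) auto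
      ultimately have "(?X2 *\<^sub>v r + ?X2 *\<^sub>v s) $ i \<le> 0" if "i < n" for i
        using that by (simp add: less_eq_vec_def del: index_mult_mat_vec)
      then have cond': "(?X2 *\<^sub>v r) $ i + (?X2 *\<^sub>v s) $ i \<le> 0" if "i < n" for i
        using that by (simp del: index_mult_mat_vec)
      have w_eq: "w = ?X2 *\<^sub>v (- 1 \<cdot>\<^sub>v (s + r)) + ?X2 *\<^sub>v (R2 *\<^sub>v w) - ?X2 *\<^sub>v (S2 *\<^sub>v w)"
        unfolding w_def by (rule s2.solution_of_A) simp
      have "(?X2 *\<^sub>v (R2 *\<^sub>v w)) $ i - (?X2 *\<^sub>v (S2 *\<^sub>v w)) $ i \<le> w $ i" if "i < n" for i
      proof -
        have "w $ i = - (?X2 *\<^sub>v s) $ i - (?X2 *\<^sub>v r) $ i + (?X2 *\<^sub>v (R2 *\<^sub>v w)) $ i - (?X2 *\<^sub>v (S2 *\<^sub>v w)) $ i"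
          using arg_cong[OF w_eq, of "\<lambda>v. v $ i"] that
          by (simp add: s2.smult_vec s2.add_vec del: index_mult_mat_vec)
        then show ?thesis using cond'[OF that] by linarith
      qed
      then have "?X2 *\<^sub>v (R2 *\<^sub>v w) - ?X2 *\<^sub>v (S2 *\<^sub>v w) \<le> w"
        by (simp add: less_eq_vec_def del: index_mult_mat_vec)
      then have "T *\<^sub>v (w @\<^sub>v w) \<le> 1 \<cdot>\<^sub>v (w @\<^sub>v w)"
        using append_vec_le[of _ n w w w] T_vec[OF wc wc] by simp
      then have "0\<^sub>v (n + n) \<le> w @\<^sub>v w"
        by (intro supersolution_nonneg[OF T T1]) auto
      moreover have "(0\<^sub>v (n + n) :: real vec) = 0\<^sub>v n @\<^sub>v 0\<^sub>v n" by (intro eq_vecI) auto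
      ultimately show ?thesis using append_vec_le[of "0\<^sub>v n" n w "0\<^sub>v n" w] by simp
    qed

    define g where "g = ?D *\<^sub>v (l \<cdot>\<^sub>v p - s)"
    have gc [simp]: "g \<in> carrier_vec n" by (simp add: g_def)
    note [simp] = carrier_vecD[OF gc]
    have key: "l * y $ i \<le> (1 - l) * g $ i" if i: "i < n" for i
    proof -
      \<comment> \<open>This is \<open>Hy\<close> regrouped: the left side is l H y, and
        substituting b = z - r + a into l p - b gives the bracket, whose four terms can each be
        handled after applying A^+.\<close>
      have "l \<cdot>\<^sub>v (A *\<^sub>v y) + l \<cdot>\<^sub>v z = (1 - l) \<cdot>\<^sub>v ((l \<cdot>\<^sub>v p - s) - (- 1 \<cdot>\<^sub>v (s + r)) - z - a)"
      proof (rule eq_vecI)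
        fix j assume "j < dim_vec ((1 - l) \<cdot>\<^sub>v ((l \<cdot>\<^sub>v p - s) - (- 1 \<cdot>\<^sub>v (s + r)) - z - a))"
        then have j: "j < m" by simp
        have "l * (p $ j - r $ j + s $ j) + l * (r $ j - a $ j + b $ j)
            = (1 - l) * ((l * p $ j - s $ j) + (s $ j + r $ j) - (r $ j - a $ j + b $ j) - a $ j)"
          using q_eq[OF j] by (simp add: algebra_simps power2_eq_square)
        then show "(l \<cdot>\<^sub>v (A *\<^sub>v y) + l \<cdot>\<^sub>v z) $ j
            = ((1 - l) \<cdot>\<^sub>v ((l \<cdot>\<^sub>v p - s) - (- 1 \<cdot>\<^sub>v (s + r)) - z - a)) $ j"
          using j Ay[OF j] by (simp add: z_eq del: index_mult_mat_vec)
      qed simp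
      then have "?D *\<^sub>v (l \<cdot>\<^sub>v (A *\<^sub>v y) + l \<cdot>\<^sub>v z)
          = ?D *\<^sub>v ((1 - l) \<cdot>\<^sub>v ((l \<cdot>\<^sub>v p - s) - (- 1 \<cdot>\<^sub>v (s + r)) - z - a))" by simp
      then have "l \<cdot>\<^sub>v y + l \<cdot>\<^sub>v (?D *\<^sub>v z) = (1 - l) \<cdot>\<^sub>v (g - w - ?D *\<^sub>v z - ?D *\<^sub>v a)"
        by (simp add: g_def w_def lift s1.smult_vec s1.add_vec s1.minus_vec)
      from arg_cong[OF this, of "\<lambda>v. v $ i"]
      have "l * y $ i + l * (?D *\<^sub>v z) $ i
          = (1 - l) * (g $ i - w $ i - (?D *\<^sub>v z) $ i - (?D *\<^sub>v a) $ i)"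
        using i yc gc wc by (simp del: index_mult_mat_vec)
      then have "(1 - l) * g $ i - l * y $ i = (1 - l) * w $ i + (?D *\<^sub>v z) $ i + (1 - l) * (?D *\<^sub>v a) $ i"
        by (simp add: algebra_simps)
      also have "\<dots> \<ge> 0"
      proof -
        have "0 \<le> w $ i" "0 \<le> (?D *\<^sub>v z) $ i" "0 \<le> (?D *\<^sub>v a) $ i"
          using w_nonneg Dz Da i carrier_vecD[OF wc]
          by (simp_all add: less_eq_vec_def del: index_mult_mat_vec)
        then show ?thesis using l1 by simp
      qed
      finally show ?thesis by simp
    qed
    have y0: "0 \<le> y $ i" if "i < n" for i using y(1) that by (simp add: less_eq_vec_def)
    have g0: "0 \<le> g $ i" if "i < n" for i
    proof -
      have "0 \<le> (1 - l) * g $ i" using key[OF that] y0[OF that] l by (meson mult_nonneg_nonneg less_imp_le order_trans)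
      then show ?thesis using l1 by (simp add: zero_le_mult_iff)
    qed
    define x where "x = g @\<^sub>v (g + y)"
    have "?X2 *\<^sub>v (R2 *\<^sub>v g) - ?X2 *\<^sub>v (S2 *\<^sub>v (g + y)) = g - l \<cdot>\<^sub>v y"
    proof -
      have "g = ?X2 *\<^sub>v (l \<cdot>\<^sub>v p - s) + ?X2 *\<^sub>v (R2 *\<^sub>v g) - ?X2 *\<^sub>v (S2 *\<^sub>v g)"
        unfolding g_def by (rule s2.solution_of_A) simp
      moreover have "?X2 *\<^sub>v p = y" using s2.D_A_vec[OF yc] lift(2) by (simp add: p_def)
      ultimately have g_eq: "g = l \<cdot>\<^sub>v y - ?X2 *\<^sub>v s + ?X2 *\<^sub>v (R2 *\<^sub>v g) - ?X2 *\<^sub>v (S2 *\<^sub>v g)"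
        by (simp add: s2.minus_vec s2.smult_vec)
      have "g $ i = l * y $ i - (?X2 *\<^sub>v s) $ i + (?X2 *\<^sub>v (R2 *\<^sub>v g)) $ i - (?X2 *\<^sub>v (S2 *\<^sub>v g)) $ i"
        if "i < n" for i
        using arg_cong[OF g_eq, of "\<lambda>v. v $ i"] that yc by (simp del: index_mult_mat_vec)
      then show ?thesis
        using yc gc by (intro eq_vecI) (auto simp: s2.add_vec s_def[symmetric] simp del: index_mult_mat_vec)
    qed
    then have Tx: "T *\<^sub>v x = (g - l \<cdot>\<^sub>v y) @\<^sub>v g"
      unfolding x_def using T_vec[of g "g + y"] by simp
    have "l \<cdot>\<^sub>v x = (l \<cdot>\<^sub>v g) @\<^sub>v (l \<cdot>\<^sub>v (g + y))"
      using gc yc unfolding x_def by (intro eq_vecI) auto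
    \<comment> \<open>Both block inequalities are rearrangements of l y <= (1 - l) g.\<close>
    moreover have "l \<cdot>\<^sub>v g \<le> g - l \<cdot>\<^sub>v y" "l \<cdot>\<^sub>v (g + y) \<le> g"
      using key gc yc by (auto simp: less_eq_vec_def algebra_simps)
    ultimately have "l \<cdot>\<^sub>v x \<le> T *\<^sub>v x"
      unfolding Tx using append_vec_le[of "l \<cdot>\<^sub>v g" n "g - l \<cdot>\<^sub>v y"] by simp
    moreover have "0\<^sub>v (n + n) \<le> x"
      using g0 y0 by (auto simp: x_def less_eq_vec_def)
    moreover have "x \<noteq> 0\<^sub>v (n + n)"
    proof
      assume "x = 0\<^sub>v (n + n)"
      obtain i where i: "i < n" "0 < y $ i" using nonneg_nonzero_vec_pos[OF y(1,2)] .
      have "x $ (n + i) = g $ i + y $ i" using i gc yc by (simp add: x_def)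
      then show False using \<open>x = 0\<^sub>v (n + n)\<close> i g0[OF i(1)] by simp
    qed
    ultimately show ?thesis using subeigenvector_le_rho[OF T] unfolding l_def by blast
  qed
  with T1 show ?thesis unfolding T_def W_def by simp
qed

end
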